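(* For the coupled system with binary (2-PAM) symbols in the regime $L,M\to\infty$ with $\alpha=L/M$ fixed (so that $\alpha'=\alpha$ and $\sigma'^2=\sigma^2$), the achievable sum-rate $\mathcal{R}_{\text{coup}}(\alpha,\sigma^2)$ satisfies $$\mathcal{C}(\sigma^2)-\max_{\alpha}\mathcal{R}_{\text{coup}}(\alpha,\sigma^2)=\frac{1}{4\ln 2\;\mathcal{C}(\sigma^2)}+\frac{1}{12\ln2\;\mathcal{C}(\sigma^2)^2}+\mathcal{O}\left(\frac{1}{\mathcal{C}(\sigma^2)^3}\right)$$ as $\sigma^2\to0$ (equivalently $\mathcal{C}(\sigma^2)\to\infty$).
   Context: Capacity of the AWGN channel with signal power $1$ and noise power $\sigma^2>0$: $\mathcal{C}(\sigma^2)=\frac12\log_2\left(1+\frac1{\sigma^2}\right)$. $\mathcal{C}_{\text{BIAWGN}}(\gamma)$ is the capacity in bits of the binary-input AWGN channel at SNR $\gamma$, i.e. $I(X;\sqrt{\gamma}X+Z)$ with $X$ uniform on $\{\pm1\}$, $Z\sim\mathcal N(0,1)$ independent. The binary MSE function is $g_2(\gamma)=\mathbb{E}\left[(1-\tanh(\gamma+\xi\sqrt\gamma))^2\right]$, $\xi\sim\mathcal N(0,1)$. $\alpha>0$ is the system load. The characteristic equation is $x=g_2\left(\frac{1}{\alpha x}\right)+\sigma^2$; $x^{(1)}=x^{(1)}(\alpha,\sigma^2)$ and $x^{(3)}=x^{(3)}(\alpha,\sigma^2)$ denote its smallest and largest solutions. Potential function, for $x\ge0$: $$U(x,\alpha)=\ln\frac{x+x^{(1)}}{x^{(1)}}-\frac{\sigma^2x}{x^{(1)}(x+x^{(1)})}-\alpha\int_{\frac{1}{\alpha(x+x^{(1)})}}^{\frac{1}{\alpha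 x^{(1)}}}g_2(y)\,dy .$$ The limiting load is $\bar\alpha(\sigma^2)=\sup\{\alpha\in(0,\mathcal{C}(\sigma^2)]:\ \min_{x\in[0,1+\sigma^2]}U(x,\alpha)\ge0\}$. The sum-rate achievable by the coupled system (two-stage demodulation/decoding, sufficiently large coupling window) is $$\mathcal{R}_{\text{coup}}(\alpha,\sigma^2)=\begin{cases}\alpha\,\mathcal{C}_{\text{BIAWGN}}\left(\frac{1}{\alpha x^{(1)}}\right), & \alpha\le\bar\alpha(\sigma^2),\\[1mm] \alpha\,\mathcal{C}_{\text{BIAWGN}}\left(\frac{1}{\alpha x^{(3)}}\right), & \alpha>\bar\alpha(\sigma^2).\end{cases}$$ *)

theory Defs
  imports "HOL-Probability.Probability" "HOL-Library.Landau_Symbols"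
begin

text \<open>Throughout, the argument \<open>v\<close> is the noise power \<open>\<sigma>\<^sup>2\<close>, \<open>a\<close> is the system load
  \<open>\<alpha>\<close> and \<open>\<gamma>\<close> is a signal-to-noise ratio.\<close>

definition awgn_capacity :: "real \<Rightarrow> real" where
  "awgn_capacity v = 1/2 * log 2 (1 + 1/v)"

text \<open>Sample space of pairs \<open>(X, Z)\<close> with \<open>X\<close> uniform on \<open>{-1, 1}\<close> and \<open>Z\<close> an independent
  standard normal variable.\<close>

definition biawgn_space :: "(real \<times> real) measure" where
  "biawgn_space = uniform_count_measure {-1, 1} \<Otimes>\<^sub>M std_normal_distribution"

lemma prob_space_biawgn_space: "prob_space biawgn_space"
proof -
  interpret A: prob_space "uniform_count_measure {-1, 1::real}"
    by (rule prob_space_uniform_count_measure) auto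
  interpret B: prob_space std_normal_distribution
    by (rule prob_space_normal_density) simp
  interpret P: pair_prob_space "uniform_count_measure {-1, 1::real}" std_normal_distribution ..
  show ?thesis
    unfolding biawgn_space_def by unfold_locales
qed

definition biawgn_capacity :: "real \<Rightarrow> real" where
  "biawgn_capacity \<gamma> =
     prob_space.mutual_information biawgn_space 2 (count_space {-1, 1}) lborel
       (\<lambda>(x, z). x) (\<lambda>(x, z). sqrt \<gamma> * x + z)"

definition g2 :: "real \<Rightarrow> real" where
  "g2 \<gamma> = (\<integral>\<xi>. (1 - tanh (\<gamma> + \<xi> * sqrt \<gamma>))\<^sup>2 \<partial>std_normal_distribution)"

text \<open>The SNR \<open>1 / (\<alpha> x)\<close> is meaningful only for \<open>x > 0\<close>. For \<open>v > 0\<close> and \<open>a > 0\<close>, the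
  function \<open>g2\<close> is continuous with values in \<open>[0, 1]\<close> on the nonnegative reals, so that the
  positive solutions form a nonempty compact subset of \<open>[v, 1 + v]\<close>, and the least and the
  greatest one exist.\<close>

definition char_solution :: "real \<Rightarrow> real \<Rightarrow> real \<Rightarrow> bool" where
  "char_solution a v x \<longleftrightarrow> x > 0 \<and> x = g2 (1 / (a * x)) + v"

definition x1 :: "real \<Rightarrow> real \<Rightarrow> real" where
  "x1 a v = (LEAST x. char_solution a v x)"

definition x3 :: "real \<Rightarrow> real \<Rightarrow> real" where
  "x3 a v = (GREATEST x. char_solution a v x)"

definition potential :: "real \<Rightarrow> real \<Rightarrow> real \<Rightarrow> real" where
  "potential v x a =
     ln ((x + x1 a v) / x1 a v)
     - v * x / (x1 a v * (x + x1 a v))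
     - a * integral {1 / (a * (x + x1 a v)) .. 1 / (a * x1 a v)} g2"

text \<open>The minimum of the potential over the compact interval is nonnegative iff all of its
  values there are.\<close>

definition limiting_load :: "real \<Rightarrow> real" where
  "limiting_load v =
     Sup {a \<in> {0<..awgn_capacity v}. \<forall>x\<in>{0..1 + v}. potential v x a \<ge> 0}"

definition coupled_rate :: "real \<Rightarrow> real \<Rightarrow> real" where
  "coupled_rate a v =
     (if a \<le> limiting_load v then a * biawgn_capacity (1 / (a * x1 a v))
      else a * biawgn_capacity (1 / (a * x3 a v)))"

end

theory Submission
  imports Defs "HOL-Analysis.Harmonic_Numbers" "HOL-Real_Asymp.Real_Asymp"
begin

text \<open>
  Put \<open>G t = \<integral>\<^sub>0\<^sup>t g\<^sub>2\<close> and \<open>\<Phi> y = ln y + v / y + a G (1 / (a y))\<close>. The critical points of \<open>\<Phi>\<close> are the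
  solutions of the characteristic equation, and the potential at \<open>x\<close> is \<open>\<Phi> (x + x\<^sub>1) - \<Phi> x\<^sub>1\<close>. The
  relation \<open>G = 2 ln 2 C\<close>, with \<open>C\<close> the capacity of the binary-input channel in bits, turns the rate at
  \<open>x\<^sub>1\<close> into \<open>(\<Phi> x\<^sub>1 - ln x\<^sub>1 - v / x\<^sub>1) / (2 ln 2)\<close>. If \<open>x\<^sub>1\<close> minimises \<open>\<Phi>\<close>, comparison with \<open>y = a / (a + 1)\<close> and
  \<open>ln x + v / x \<ge> ln v + 1\<close> bound this rate by \<open>(- 1 / (2 a) - 1 / (6 a\<^sup>2) - ln v) / (2 ln 2)\<close> up to
  \<open>O(a\<^sup>-\<^sup>3)\<close>, which is the asserted expansion. Conversely \<open>\<Phi> x\<^sub>1 \<le> \<Phi> v \<le> ln v + 1 + 2 a ln 2\<close>, and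
  \<open>\<Phi> y \<ge> 1 - 1 / (2 a) - 1 / (6 a\<^sup>2) - O(a\<^sup>-\<^sup>3)\<close> away from \<open>0\<close>, so a load slightly below the asserted
  value is admissible. Since \<open>x\<^sub>1 \<le> 2 v\<close>, load and rate differ by an exponentially small amount
  there, and beyond the limiting load the rate is bounded because \<open>x\<^sub>3\<close> is of order \<open>1\<close>.
\<close>

subsection \<open>The binary mean squared error as a Gaussian mean of the hyperbolic secant\<close>

text \<open>The argument \<open>r\<^sup>2 + \<xi> * r\<close> is \<open>r\<close> times a Gaussian
  of mean \<open>r\<close>. The substitutions \<open>\<xi> = w - r\<close> and
  \<open>\<xi> = - w - r\<close> turn the shift of the mean into the weights
  \<open>exp (- r\<^sup>2 / 2) * exp (r * w)\<close> and
  \<open>exp (- r\<^sup>2 / 2) * exp (- (r * w))\<close> under the centred law; averaging the two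
  versions cancels whatever is odd in the tilted integrand.\<close>

lemma std_normal_expectation_symmetrize:
  fixes f :: "real \<Rightarrow> real"
  assumes int: "integrable std_normal_distribution (\<lambda>\<xi>. f (r\<^sup>2 + \<xi> * r))"
    and [measurable]: "f \<in> borel_measurable borel"
  shows "(\<integral>\<xi>. f (r\<^sup>2 + \<xi> * r) \<partial>std_normal_distribution) =
    exp (- r\<^sup>2 / 2) *
      (\<integral>w. (exp (r * w) * f (r * w) + exp (- (r * w)) * f (- (r * w))) / 2 \<partial>std_normal_distribution)"
proof -
  let ?I = "\<integral>\<xi>. f (r\<^sup>2 + \<xi> * r) \<partial>std_normal_distribution"
  have int': "integrable lborel (\<lambda>z. std_normal_density z * f (r\<^sup>2 + z * r))"
    using int by (subst (asm) integrable_density) (auto simp: normal_density_nonneg)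
  have I: "?I = (\<integral>z. std_normal_density z * f (r\<^sup>2 + z * r) \<partial>lborel)"
    by (subst integral_density) (auto simp: normal_density_nonneg)
  let ?p = "\<lambda>w. std_normal_density (w - r) * f (r * w)"
  let ?q = "\<lambda>w. std_normal_density (w + r) * f (- (r * w))"
  have p: "(\<lambda>z. std_normal_density (-r + 1 * z) * f (r\<^sup>2 + (-r + 1 * z) * r)) = ?p"
    by (auto simp: fun_eq_iff power2_eq_square algebra_simps)
  have q: "(\<lambda>z. std_normal_density (-r + (-1) * z) * f (r\<^sup>2 + (-r + (-1) * z) * r)) = ?q"
    by (auto simp: fun_eq_iff power2_eq_square algebra_simps std_normal_density_def)
  have I1: "?I = (\<integral>w. ?p w \<partial>lborel)" and int1: "integrable lborel ?p"
    using lborel_integral_real_affine[of 1 "\<lambda>z. std_normal_density z * f (r\<^sup>2 + z * r)" "-r"]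
      lborel_integrable_real_affine[OF int', of 1 "-r"] unfolding p by (simp_all add: I)
  have I2: "?I = (\<integral>w. ?q w \<partial>lborel)" and int2: "integrable lborel ?q"
    using lborel_integral_real_affine[of "-1" "\<lambda>z. std_normal_density z * f (r\<^sup>2 + z * r)" "-r"]
      lborel_integrable_real_affine[OF int', of "-1" "-r"] unfolding q by (simp_all add: I)
  have "?I = (\<integral>w. (?p w + ?q w) / 2 \<partial>lborel)"
    using int1 int2 by (simp add: I1[symmetric] I2[symmetric])
  also have "(\<lambda>w. (?p w + ?q w) / 2) = (\<lambda>w. exp (- r\<^sup>2 / 2) * (std_normal_density w *
      ((exp (r * w) * f (r * w) + exp (- (r * w)) * f (- (r * w))) / 2)))"
  proof
    fix w
    have "- (w - r)\<^sup>2 / 2 = - r\<^sup>2 / 2 + - w\<^sup>2 / 2 + r * w"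
      "- (w + r)\<^sup>2 / 2 = - r\<^sup>2 / 2 + - w\<^sup>2 / 2 + - (r * w)"
      by (simp_all add: power2_eq_square field_simps)
    then have "std_normal_density (w - r) = exp (- r\<^sup>2 / 2) * std_normal_density w * exp (r * w)"
      "std_normal_density (w + r) = exp (- r\<^sup>2 / 2) * std_normal_density w * exp (- (r * w))"
      unfolding std_normal_density_def by (simp_all only: exp_add mult_ac)
    then show "(?p w + ?q w) / 2 = exp (- r\<^sup>2 / 2) * (std_normal_density w *
      ((exp (r * w) * f (r * w) + exp (- (r * w)) * f (- (r * w))) / 2))"
      by (simp only:) (simp add: field_simps)
  qed
  also have "(\<integral>w. exp (- r\<^sup>2 / 2) * (std_normal_density w *
      ((exp (r * w) * f (r * w) + exp (- (r * w)) * f (- (r * w))) / 2)) \<partial>lborel) =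
    exp (- r\<^sup>2 / 2) * (\<integral>w. std_normal_density w *
      ((exp (r * w) * f (r * w) + exp (- (r * w)) * f (- (r * w))) / 2) \<partial>lborel)"
    by (rule integral_mult_right_zero)
  also have "(\<integral>w. std_normal_density w *
      ((exp (r * w) * f (r * w) + exp (- (r * w)) * f (- (r * w))) / 2) \<partial>lborel) =
     (\<integral>w. (exp (r * w) * f (r * w) + exp (- (r * w)) * f (- (r * w))) / 2 \<partial>std_normal_distribution)"
    by (subst integral_density) (auto simp: normal_density_nonneg)
  finally show ?thesis .
qed

lemma prob_space_std_normal: "prob_space std_normal_distribution"
  by (rule prob_space_normal_density) simp

lemma integrable_std_normal_bounded:
  fixes f :: "real \<Rightarrow> real"
  assumes "f \<in> borel_measurable borel" "\<And>x. \<bar>f x\<bar> \<le> B"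
  shows "integrable std_normal_distribution f"
proof -
  interpret prob_space std_normal_distribution by (rule prob_space_std_normal)
  show ?thesis
    using assms by (intro integrable_const_bound[where B = B]) auto
qed

lemma one_minus_tanh: "1 - tanh (x::real) = exp (- x) / cosh x"
proof -
  have "cosh x \<noteq> 0"
    using cosh_real_pos[of x] by linarith
  then have "1 - tanh x = (cosh x - sinh x) / cosh x"
    by (simp add: tanh_def diff_divide_distrib)
  then show ?thesis
    by (simp add: cosh_minus_sinh)
qed

lemma one_plus_tanh: "1 + tanh (x::real) = exp x / cosh x"
proof -
  have "cosh x \<noteq> 0"
    using cosh_real_pos[of x] by linarith
  then have "1 + tanh x = (cosh x + sinh x) / cosh x"
    by (simp add: tanh_def add_divide_distrib)
  then show ?thesis
    by (simp add: cosh_plus_sinh)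
qed

lemma exp_plus_exp_minus: "exp (x::real) + exp (- x) = 2 * cosh x"
  by (simp add: cosh_def)

lemma borel_measurable_tanh [measurable]: "(tanh :: real \<Rightarrow> real) \<in> borel_measurable borel"
  by (intro borel_measurable_continuous_onI continuous_intros) (auto)

lemma borel_measurable_cosh [measurable]: "(cosh :: real \<Rightarrow> real) \<in> borel_measurable borel"
  by (intro borel_measurable_continuous_onI continuous_intros)

lemma abs_tanh_le_1: "\<bar>tanh (x::real)\<bar> \<le> 1"
  using tanh_real_bounds[of x] by auto

definition mean_sech :: "real \<Rightarrow> real" where
  "mean_sech s = (\<integral>w. 1 / cosh (sqrt s * w) \<partial>std_normal_distribution)"

lemma sech_le_1: "1 / cosh (x::real) \<le> 1"
  by (simp add: divide_le_eq cosh_real_pos cosh_real_ge_1)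

lemma sech_pos: "1 / cosh (x::real) > 0"
  by (simp add: cosh_real_pos)

lemma integrable_sech: "integrable std_normal_distribution (\<lambda>w. 1 / cosh (r * w))"
proof (rule integrable_std_normal_bounded[where B = 1])
  show "\<bar>1 / cosh (r * x)\<bar> \<le> 1" for x
    using sech_le_1[of "r * x"] sech_pos[of "r * x"] by linarith
qed measurable

text \<open>With \<open>1 - tanh x = exp (- x) / cosh x\<close> the symmetrized integrand collapses
  to sech. The product form isolates the exponential decay and makes monotonicity, continuity and
  Taylor bounds of \<open>g2\<close> accessible.\<close>

lemma g2_eq:
  assumes "s \<ge> 0"
  shows "g2 s = exp (- s / 2) * mean_sech s"
proof -
  let ?f = "\<lambda>x::real. (1 - tanh x)\<^sup>2"
  have b: "\<bar>?f x\<bar> \<le> 4" for x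
    using abs_tanh_le_1[of x] power_mono[of "1 - tanh x" 2 2] by (simp add: abs_le_iff)
  have f: "(exp x * ?f x + exp (- x) * ?f (- x)) / 2 = 1 / cosh x" for x
  proof -
    have e: "exp x * exp (- x) = 1"
      by (rule exp_minus_inverse)
    have "exp x * ?f x = (exp x * exp (- x)) * exp (- x) / (cosh x)\<^sup>2"
      by (simp only: one_minus_tanh power_divide power2_eq_square times_divide_eq_right
          times_divide_eq_left divide_divide_eq_left mult.assoc)
    moreover have "exp (- x) * ?f (- x) = (exp x * exp (- x)) * exp x / (cosh x)\<^sup>2"
      by (simp only: tanh_minus diff_minus_eq_add one_plus_tanh power_divide power2_eq_square
          times_divide_eq_right times_divide_eq_left divide_divide_eq_left mult_ac)
    ultimately have "(exp x * ?f x + exp (- x) * ?f (- x)) / 2 = (exp x + exp (- x)) / (2 * (cosh x)\<^sup>2)"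
      unfolding e by (simp add: add_divide_distrib)
    also have "\<dots> = 1 / cosh x"
      unfolding exp_plus_exp_minus by (simp add: power2_eq_square)
    finally show ?thesis .
  qed
  have "integrable std_normal_distribution (\<lambda>\<xi>. ?f ((sqrt s)\<^sup>2 + \<xi> * sqrt s))"
    by (rule integrable_std_normal_bounded[where B = 4, OF _ b]) measurable
  moreover have "?f \<in> borel_measurable borel"
    by measurable
  ultimately have "(\<integral>\<xi>. ?f ((sqrt s)\<^sup>2 + \<xi> * sqrt s) \<partial>std_normal_distribution) =
      exp (- (sqrt s)\<^sup>2 / 2) * mean_sech s"
    unfolding mean_sech_def by (subst std_normal_expectation_symmetrize) (simp_all only: f)
  then show ?thesis
    using assms by (simp add: g2_def)
qed

section \<open>Polynomial bounds for exp, cosh and sech\<close>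

lemma exp_minus_bounds:
  fixes x :: real
  assumes "x \<ge> 0"
  shows exp_minus_le_quadratic: "exp (- x) \<le> 1 - x + x\<^sup>2 / 2"
    and exp_minus_ge_cubic: "1 - x + x\<^sup>2 / 2 - x ^ 3 / 6 \<le> exp (- x)"
proof -
  obtain t where "exp (- x) = (\<Sum>m<3. (- x) ^ m / fact m) + exp t / fact 3 * (- x) ^ 3"
    using Maclaurin_exp_le by blast
  then have "exp (- x) = 1 - x + x\<^sup>2 / 2 - exp t / 6 * x ^ 3"
    by (simp add: eval_nat_numeral)
  moreover have "exp t / 6 * x ^ 3 \<ge> 0"
    using assms by simp
  ultimately show "exp (- x) \<le> 1 - x + x\<^sup>2 / 2"
    by linarith
  obtain t where "exp (- x) = (\<Sum>m<4. (- x) ^ m / fact m) + exp t / fact 4 * (- x) ^ 4"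
    using Maclaurin_exp_le by blast
  then have "exp (- x) = 1 - x + x\<^sup>2 / 2 - x ^ 3 / 6 + exp t / 24 * x ^ 4"
    by (simp add: eval_nat_numeral)
  moreover have "exp t / 24 * x ^ 4 \<ge> 0"
    by simp
  ultimately show "1 - x + x\<^sup>2 / 2 - x ^ 3 / 6 \<le> exp (- x)"
    by linarith
qed

text \<open>Averaging the sixth-order Lagrange forms of exp at x and -x cancels the odd terms and
  leaves \<open>(exp t + exp u) / 1440 * x ^ 6\<close>. It is nonnegative, and for |x| at most 1 its
  coefficient is at most 6/1440 = 1/240 because e is at most 3.\<close>

lemma cosh_bounds:
  fixes x :: real
  shows cosh_ge_quartic: "1 + x\<^sup>2 / 2 + x ^ 4 / 24 \<le> cosh x"
    and cosh_le_sextic: "\<bar>x\<bar> \<le> 1 \<Longrightarrow> cosh x \<le> 1 + x\<^sup>2 / 2 + x ^ 4 / 24 + x ^ 6 / 240"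
proof -
  obtain t where t: "\<bar>t\<bar> \<le> \<bar>x\<bar>" "exp x = (\<Sum>m<6. x ^ m / fact m) + exp t / fact 6 * x ^ 6"
    using Maclaurin_exp_le by blast
  obtain u where u: "\<bar>u\<bar> \<le> \<bar>-x\<bar>" "exp (-x) = (\<Sum>m<6. (-x) ^ m / fact m) + exp u / fact 6 * (-x) ^ 6"
    using Maclaurin_exp_le by blast
  have c: "cosh x = 1 + x\<^sup>2 / 2 + x ^ 4 / 24 + (exp t + exp u) / 1440 * x ^ 6"
    unfolding cosh_def t(2) u(2) by (simp add: eval_nat_numeral) (simp add: field_simps)
  have "0 \<le> (exp t + exp u) / 1440 * x ^ 6"
    by simp
  then show "1 + x\<^sup>2 / 2 + x ^ 4 / 24 \<le> cosh x"
    unfolding c by linarith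
  show "cosh x \<le> 1 + x\<^sup>2 / 2 + x ^ 4 / 24 + x ^ 6 / 240" if "\<bar>x\<bar> \<le> 1"
  proof -
    have "exp t \<le> 3" "exp u \<le> 3"
      using t(1) u(1) that exp_le exp_le_cancel_iff[of t 1] exp_le_cancel_iff[of u 1] by linarith+
    then have "(exp t + exp u) / 1440 \<le> 1 / 240"
      by simp
    then have "(exp t + exp u) / 1440 * x ^ 6 \<le> 1 / 240 * x ^ 6"
      by (intro mult_right_mono) auto
    then show ?thesis
      unfolding c by linarith
  qed
qed

text \<open>The quartic Taylor polynomial of sech times the quartic lower bound of cosh is 1 plus
  nonnegative terms in y = x^2. Completing a square shows that the polynomial itself is nonnegative,
  so the bound of cosh may be multiplied by it.\<close>

lemma sech_le_quartic: "1 / cosh (x::real) \<le> 1 - x\<^sup>2 / 2 + 5 * x ^ 4 / 24"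
proof -
  define y where "y = x\<^sup>2"
  have y: "y \<ge> 0" "x ^ 4 = y\<^sup>2"
    by (simp_all add: y_def)
  have q: "0 \<le> 1 - y / 2 + 5 * y\<^sup>2 / 24"
  proof -
    have "1 - y / 2 + 5 * y\<^sup>2 / 24 = (1 - y / 4)\<^sup>2 + 7 * y\<^sup>2 / 48"
      by (simp add: power2_eq_square field_simps)
    then show ?thesis
      by simp
  qed
  have "1 \<le> 1 + y ^ 3 / 12 + 5 * y ^ 4 / 576"
    using y by simp
  also have "\<dots> = (1 - y / 2 + 5 * y\<^sup>2 / 24) * (1 + y / 2 + y\<^sup>2 / 24)"
    by (simp add: field_simps eval_nat_numeral)
  also have "\<dots> \<le> (1 - y / 2 + 5 * y\<^sup>2 / 24) * cosh x"
    using cosh_ge_quartic[of x, unfolded y, folded y_def] q by (intro mult_left_mono)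
  finally show ?thesis
    unfolding y y_def[symmetric] by (simp add: divide_le_eq cosh_real_pos)
qed

text \<open>The coefficient 1 of x^6 is deliberately crude: it makes the left side nonpositive for
  |x| > 1, where nothing is left to prove. On |x| at most 1 the product with the sextic upper bound
  of cosh is 1 minus nonnegative terms.\<close>

lemma sech_ge_sextic: "1 - x\<^sup>2 / 2 + 5 * x ^ 4 / 24 - x ^ 6 \<le> 1 / cosh (x::real)"
proof -
  define y where "y = x\<^sup>2"
  have y: "y \<ge> 0" "x ^ 4 = y\<^sup>2" "x ^ 6 = y ^ 3"
    by (simp_all add: y_def flip: power_mult)
  define p where "p = 1 - y / 2 + 5 * y\<^sup>2 / 24 - y ^ 3"
  have "p \<le> 1 / cosh x"
  proof (cases "p \<le> 0")
    case True
    then show ?thesis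
      using sech_pos[of x] by linarith
  next
    case False
    have "y \<le> 1"
    proof (rule ccontr)
      assume "\<not> y \<le> 1"
      then have "y\<^sup>2 \<ge> 1" "y ^ 3 \<ge> y\<^sup>2"
        using power_increasing[of 2 3 y] by auto
      with \<open>\<not> y \<le> 1\<close> False show False
        unfolding p_def by linarith
    qed
    have "p * cosh x \<le> p * (1 + y / 2 + y\<^sup>2 / 24 + y ^ 3 / 240)"
      using cosh_le_sextic[of x, unfolded y, folded abs_square_le_1 y_def] False \<open>y \<le> 1\<close>
      by (intro mult_left_mono) auto
    also have "\<dots> = 1 - (y ^ 3 * 73 / 80 + y ^ 4 * 1421 / 2880 + y ^ 5 * 47 / 1152 + y ^ 6 / 240)"
      unfolding p_def by (simp add: field_simps eval_nat_numeral)
    also have "\<dots> \<le> 1"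
      using zero_le_power[OF y(1), of 3] zero_le_power[OF y(1), of 4] zero_le_power[OF y(1), of 5]
        zero_le_power[OF y(1), of 6] by linarith
    finally show ?thesis
      by (simp add: le_divide_eq cosh_real_pos)
  qed
  then show ?thesis
    unfolding p_def y y_def[symmetric] .
qed

lemma sech_lipschitz: "\<bar>1 / cosh p - 1 / cosh q\<bar> \<le> \<bar>p - (q::real)\<bar>"
proof -
  have "norm (1 / cosh p - 1 / cosh q) \<le> 1 * norm (p - q)"
  proof (rule field_differentiable_bound[where S = UNIV and f' = "\<lambda>x. - (sinh x) / (cosh x)\<^sup>2"])
    show "((\<lambda>x. 1 / cosh x) has_field_derivative - (sinh z) / (cosh z)\<^sup>2) (at z within UNIV)" for z :: real
      using cosh_real_pos[of z] by (auto intro!: derivative_eq_intros simp: power2_eq_square)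
    show "norm (- (sinh z) / (cosh z)\<^sup>2) \<le> 1" for z :: real
    proof -
      have "- (sinh z) / (cosh z)\<^sup>2 = - (tanh z * (1 / cosh z))"
        by (simp add: tanh_def power2_eq_square)
      moreover have "\<bar>tanh z\<bar> * \<bar>1 / cosh z\<bar> \<le> 1 * 1"
        using abs_tanh_le_1[of z] sech_le_1[of z] sech_pos[of z] by (intro mult_mono) auto
      ultimately show ?thesis
        by (simp add: abs_mult)
    qed
  qed auto
  then show ?thesis
    by simp
qed

lemma sech_antimono: "\<bar>p\<bar> \<le> \<bar>q\<bar> \<Longrightarrow> 1 / cosh q \<le> 1 / cosh (p::real)"
  using cosh_real_nonneg_le_iff[of "\<bar>p\<bar>" "\<bar>q\<bar>"] by (simp add: frac_le cosh_real_pos)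

section \<open>Gaussian moments and the mean of the hyperbolic secant\<close>

lemma std_normal_expectation_lborel:
  fixes f :: "real \<Rightarrow> real"
  assumes [measurable]: "f \<in> borel_measurable borel"
  shows "(\<integral>x. f x \<partial>std_normal_distribution) = (\<integral>x. std_normal_density x * f x \<partial>lborel)"
  by (subst integral_density) (auto simp: normal_density_nonneg)

lemma std_normal_moments:
  shows std_normal_moment_2: "(\<integral>x. x\<^sup>2 \<partial>std_normal_distribution) = 1"
    and std_normal_moment_4: "(\<integral>x. x ^ 4 \<partial>std_normal_distribution) = 3"
    and std_normal_moment_6: "(\<integral>x. x ^ 6 \<partial>std_normal_distribution) = 15"
  using integral_std_normal_moment_even[of 1] integral_std_normal_moment_even[of 2]
    integral_std_normal_moment_even[of 3]
  by (simp_all add: std_normal_expectation_lborel fact_numeral)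

lemma integrable_std_normal_power: "integrable std_normal_distribution (\<lambda>x. x ^ k)"
  using integrable_std_normal_moment[of k]
  by (subst integrable_density) (auto simp: normal_density_nonneg)

lemma integrable_std_normal_abs: "integrable std_normal_distribution (\<lambda>x. \<bar>x\<bar>)"
  using integrable_std_normal_power[of 1] by (auto intro: integrable_abs)

lemma std_normal_mean_abs_le_1: "(\<integral>x. \<bar>x\<bar> \<partial>std_normal_distribution) \<le> 1"
proof -
  interpret prob_space std_normal_distribution by (rule prob_space_std_normal)
  have "(\<integral>x. \<bar>x\<bar> \<partial>std_normal_distribution) \<le> (\<integral>x. (1 + x\<^sup>2) / 2 \<partial>std_normal_distribution)"
  proof (intro integral_mono integrable_std_normal_abs)
    show "\<bar>x\<bar> \<le> (1 + x\<^sup>2) / 2" for x :: real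
      using zero_le_power2[of "\<bar>x\<bar> - 1"] by (simp add: power2_eq_square algebra_simps)
  qed (auto intro!: integrable_std_normal_power)
  also have "\<dots> = 1"
    using prob_space by (simp add: integrable_std_normal_power std_normal_moment_2)
  finally show ?thesis .
qed

lemma mean_sech_nonneg: "0 \<le> mean_sech s"
  unfolding mean_sech_def by (intro integral_nonneg_AE) (auto intro!: less_imp_le[OF sech_pos])

lemma mean_sech_le_1: "mean_sech s \<le> 1"
proof -
  interpret prob_space std_normal_distribution by (rule prob_space_std_normal)
  have "mean_sech s \<le> (\<integral>w. 1 \<partial>std_normal_distribution)"
    unfolding mean_sech_def by (intro integral_mono integrable_sech sech_le_1) auto
  then show ?thesis
    using prob_space by simp
qed

lemma mean_sech_antimono:
  assumes "0 \<le> s" "s \<le> t"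
  shows "mean_sech t \<le> mean_sech s"
  unfolding mean_sech_def
proof (intro integral_mono integrable_sech sech_antimono)
  show "\<bar>sqrt s * w\<bar> \<le> \<bar>sqrt t * w\<bar>" for w
    using assms by (simp add: abs_mult mult_right_mono)
qed

text \<open>sech is 1-Lipschitz and the mean of |w| is at most 1. The estimate gives continuity of
  \<open>g2\<close> up to 0 and, since sqrt is itself Lipschitz away from 0, the difference bound
  for large arguments.\<close>

lemma mean_sech_lipschitz_sqrt: "\<bar>mean_sech s - mean_sech t\<bar> \<le> \<bar>sqrt s - sqrt t\<bar>"
proof -
  have "\<bar>mean_sech s - mean_sech t\<bar> =
      \<bar>\<integral>w. 1 / cosh (sqrt s * w) - 1 / cosh (sqrt t * w) \<partial>std_normal_distribution\<bar>"
    unfolding mean_sech_def by (subst Bochner_Integration.integral_diff[OF integrable_sech integrable_sech]) simp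
  also have "\<dots> \<le> (\<integral>w. \<bar>1 / cosh (sqrt s * w) - 1 / cosh (sqrt t * w)\<bar> \<partial>std_normal_distribution)"
    by (rule integral_abs_bound)
  also have "\<dots> \<le> (\<integral>w. \<bar>sqrt s - sqrt t\<bar> * \<bar>w\<bar> \<partial>std_normal_distribution)"
  proof (rule integral_mono)
    show "\<bar>1 / cosh (sqrt s * w) - 1 / cosh (sqrt t * w)\<bar> \<le> \<bar>sqrt s - sqrt t\<bar> * \<bar>w\<bar>" for w
      using sech_lipschitz[of "sqrt s * w" "sqrt t * w"]
      by (simp add: abs_mult flip: left_diff_distrib)
  qed (auto intro!: integrable_abs Bochner_Integration.integrable_diff integrable_sech integrable_std_normal_abs)
  also have "\<dots> = \<bar>sqrt s - sqrt t\<bar> * (\<integral>w. \<bar>w\<bar> \<partial>std_normal_distribution)"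
    by simp
  also have "\<dots> \<le> \<bar>sqrt s - sqrt t\<bar> * 1"
    by (intro mult_left_mono std_normal_mean_abs_le_1) simp
  finally show ?thesis
    by simp
qed

text \<open>The sech bounds are integrated against the moments 1, 3 and 15 of orders 2, 4 and 6,
  whence 5/24 * 3 = 5/8 and the error 15 s^3.\<close>

lemma mean_sech_bounds:
  assumes "s \<ge> 0"
  shows mean_sech_le_quadratic: "mean_sech s \<le> 1 - s / 2 + 5 * s\<^sup>2 / 8"
    and mean_sech_ge_cubic: "1 - s / 2 + 5 * s\<^sup>2 / 8 - 15 * s ^ 3 \<le> mean_sech s"
proof -
  interpret prob_space std_normal_distribution by (rule prob_space_std_normal)
  have pow: "(sqrt s * w)\<^sup>2 = s * w\<^sup>2" "(sqrt s * w) ^ 4 = s\<^sup>2 * w ^ 4" "(sqrt s * w) ^ 6 = s ^ 3 * w ^ 6" for w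
  proof -
    have "sqrt s ^ 4 = (sqrt s ^ 2) ^ 2" "sqrt s ^ 6 = (sqrt s ^ 2) ^ 3"
      by (simp_all flip: power_mult)
    then show "(sqrt s * w)\<^sup>2 = s * w\<^sup>2" "(sqrt s * w) ^ 4 = s\<^sup>2 * w ^ 4" "(sqrt s * w) ^ 6 = s ^ 3 * w ^ 6"
      using assms by (simp_all add: power_mult_distrib)
  qed
  have "mean_sech s \<le> (\<integral>w. 1 - s * w\<^sup>2 / 2 + 5 * (s\<^sup>2 * w ^ 4) / 24 \<partial>std_normal_distribution)"
    unfolding mean_sech_def
    by (intro integral_mono integrable_sech)
      (simp_all add: integrable_std_normal_power sech_le_quartic[of "sqrt s * _", unfolded pow])
  also have "\<dots> = 1 - s / 2 + 5 * s\<^sup>2 / 8"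
    using prob_space
    by (simp add: integrable_std_normal_power std_normal_moment_2 std_normal_moment_4)
  finally show "mean_sech s \<le> 1 - s / 2 + 5 * s\<^sup>2 / 8" .
  have "1 - s / 2 + 5 * s\<^sup>2 / 8 - 15 * s ^ 3 =
      (\<integral>w. 1 - s * w\<^sup>2 / 2 + 5 * (s\<^sup>2 * w ^ 4) / 24 - s ^ 3 * w ^ 6 \<partial>std_normal_distribution)"
    using prob_space
    by (simp add: integrable_std_normal_power std_normal_moment_2 std_normal_moment_4 std_normal_moment_6)
  also have "\<dots> \<le> mean_sech s"
    unfolding mean_sech_def
    by (intro integral_mono integrable_sech)
      (simp_all add: integrable_std_normal_power sech_ge_sextic[of "sqrt s * _", unfolded pow])
  finally show "1 - s / 2 + 5 * s\<^sup>2 / 8 - 15 * s ^ 3 \<le> mean_sech s" .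
qed

section \<open>Decay, continuity and Taylor bounds of the mean squared error\<close>

lemma g2_nonneg: "s \<ge> 0 \<Longrightarrow> 0 \<le> g2 s"
  by (simp add: g2_eq mean_sech_nonneg)

lemma g2_le_exp: "s \<ge> 0 \<Longrightarrow> g2 s \<le> exp (- s / 2)"
  using mult_left_mono[OF mean_sech_le_1[of s], of "exp (- s / 2)"] by (simp add: g2_eq)

lemma g2_le_1: "s \<ge> 0 \<Longrightarrow> g2 s \<le> 1"
  using g2_le_exp[of s] one_le_exp_iff[of "- s / 2"] exp_le_one_iff[of "- s / 2"] by linarith

lemma g2_antimono: "0 \<le> s \<Longrightarrow> s \<le> t \<Longrightarrow> g2 t \<le> g2 s"
  by (simp add: g2_eq mult_mono mean_sech_antimono mean_sech_nonneg)

lemma continuous_on_g2: "continuous_on {0..} g2"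
proof -
  have "continuous_on UNIV mean_sech"
    unfolding continuous_on_iff
  proof safe
    fix x e :: real assume "e > 0"
    have "continuous_on UNIV sqrt"
      by (intro continuous_intros)
    then obtain d where "d > 0" "\<And>y. dist y x < d \<Longrightarrow> dist (sqrt y) (sqrt x) < e"
      using \<open>e > 0\<close> unfolding continuous_on_iff by blast
    then show "\<exists>d>0. \<forall>y\<in>UNIV. dist y x < d \<longrightarrow> dist (mean_sech y) (mean_sech x) < e"
      using mean_sech_lipschitz_sqrt[of _ x] unfolding dist_real_def
      by (intro exI[of _ d]) (auto intro: le_less_trans)
  qed
  then have "continuous_on {0..} (\<lambda>s. exp (- s / 2) * mean_sech s)"
    by (auto intro!: continuous_intros intro: continuous_on_subset)
  then show ?thesis
    by (rule continuous_on_eq) (simp add: g2_eq)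
qed

text \<open>A Lipschitz bound with exponentially small constant. The factors
  \<open>exp (- s / 2)\<close> and \<open>mean_sech\<close> of \<open>g2\<close> contribute half of
  it each; for \<open>mean_sech\<close> this uses that sqrt has slope at most 1/2 beyond 1.\<close>

lemma g2_diff_le:
  assumes "1 \<le> s" "s \<le> t"
  shows "g2 s - g2 t \<le> exp (- s / 2) * (t - s)"
proof -
  have sq: "sqrt t - sqrt s \<le> (t - s) / 2"
  proof -
    have "1 \<le> sqrt s" "sqrt s \<le> sqrt t"
      using assms by auto
    then have "2 \<le> sqrt t + sqrt s" "0 \<le> sqrt t - sqrt s"
      by linarith+
    then have "(sqrt t - sqrt s) * 2 \<le> (sqrt t - sqrt s) * (sqrt t + sqrt s)"
      by (rule mult_left_mono)
    also have "\<dots> = t - s"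
      using assms by (simp add: algebra_simps)
    finally show ?thesis
      by simp
  qed
  have m: "mean_sech s - mean_sech t \<le> (t - s) / 2"
    using mean_sech_lipschitz_sqrt[of s t] sq assms by (simp add: abs_le_iff)
  have e: "exp (- s / 2) - exp (- t / 2) \<le> exp (- s / 2) * ((t - s) / 2)"
  proof -
    have "exp (- t / 2) = exp (- s / 2) * exp (- ((t - s) / 2))"
      by (simp add: field_simps flip: exp_add)
    moreover have "1 - exp (- ((t - s) / 2)) \<le> (t - s) / 2"
      using exp_ge_add_one_self[of "- ((t - s) / 2)"] by linarith
    ultimately show ?thesis
      using mult_left_mono[of "1 - exp (- ((t - s) / 2))" "(t - s) / 2" "exp (- s / 2)"]
      by (simp add: algebra_simps)
  qed
  have "g2 s - g2 t = exp (- s / 2) * (mean_sech s - mean_sech t)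
      + (exp (- s / 2) - exp (- t / 2)) * mean_sech t"
    using assms by (simp add: g2_eq algebra_simps)
  also have "\<dots> \<le> exp (- s / 2) * ((t - s) / 2) + (exp (- s / 2) - exp (- t / 2)) * 1"
    using assms m mean_sech_le_1 by (intro add_mono mult_left_mono) auto
  also have "\<dots> \<le> exp (- s / 2) * ((t - s) / 2) + exp (- s / 2) * ((t - s) / 2)"
    unfolding mult_1_right by (intro add_left_mono e)
  also have "\<dots> = exp (- s / 2) * (t - s)"
    by (simp add: field_simps)
  finally show ?thesis .
qed

lemma g2_taylor:
  assumes "0 \<le> s" "s \<le> 1"
  shows g2_le_quadratic: "g2 s \<le> 1 - s + s\<^sup>2"
    and g2_ge_cubic: "1 - s + s\<^sup>2 - 16 * s ^ 3 \<le> g2 s"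
proof -
  have "g2 s \<le> (1 - s / 2 + s\<^sup>2 / 8) * (1 - s / 2 + 5 * s\<^sup>2 / 8)"
    using assms exp_minus_le_quadratic[of "s / 2"] mean_sech_le_quadratic[of s]
    by (auto simp: g2_eq power_divide intro!: mult_mono mean_sech_nonneg add_nonneg_nonneg)
  also have "\<dots> = 1 - s + s\<^sup>2 - s ^ 3 * (3 / 8 - 5 / 64 * s)"
    by (simp add: field_simps eval_nat_numeral)
  also have "\<dots> \<le> 1 - s + s\<^sup>2"
    using assms by simp
  finally show "g2 s \<le> 1 - s + s\<^sup>2" .
  \<comment> \<open>A lower bound of the exponential factor with values in [0, 1], so that
    multiplying by it preserves the lower bound of \<open>mean_sech\<close> and does not increase
    the error 15 s^3.\<close>
  define A where "A = 1 - s / 2 + s\<^sup>2 / 8 - s ^ 3 / 48"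
  have pow: "s\<^sup>2 \<le> s" "s ^ 3 \<le> s\<^sup>2" "s ^ 4 \<le> s ^ 3" "s ^ 5 \<le> s ^ 3" "0 \<le> s ^ 3" "0 \<le> s ^ 2"  "0 \<le> s ^ 4"  "0 \<le> s ^ 5"
    using assms power_decreasing[of 1 2 s] power_decreasing[of 2 3 s] power_decreasing[of 3 4 s]
      power_decreasing[of 3 5 s] by auto
  have "0 \<le> A" "A \<le> 1"
    unfolding A_def using assms pow by linarith+
  moreover have "A \<le> exp (- s / 2)"
    using exp_minus_ge_cubic[of "s / 2"] assms by (simp add: A_def power_divide)
  ultimately have A: "0 \<le> A" "A \<le> 1" "A \<le> exp (- s / 2)"
    by auto
  have "1 - s + s\<^sup>2 - 16 * s ^ 3 \<le> A * (1 - s / 2 + 5 * s\<^sup>2 / 8) - 15 * s ^ 3"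
  proof -
    have "A * (1 - s / 2 + 5 * s\<^sup>2 / 8) = 1 - s + s\<^sup>2 - 19 / 48 * s ^ 3 + 17 / 192 * s ^ 4 - 5 / 384 * s ^ 5"
      unfolding A_def by (simp add: field_simps eval_nat_numeral)
    with pow show ?thesis
      by linarith
  qed
  also have "\<dots> \<le> A * (1 - s / 2 + 5 * s\<^sup>2 / 8) - A * (15 * s ^ 3)"
    using A pow mult_right_mono[of A 1 "15 * s ^ 3"] by simp
  also have "\<dots> = A * (1 - s / 2 + 5 * s\<^sup>2 / 8 - 15 * s ^ 3)"
    by (simp add: algebra_simps)
  also have "\<dots> \<le> A * mean_sech s"
    using A mean_sech_ge_cubic[of s] assms by (intro mult_left_mono) auto
  also have "\<dots> \<le> g2 s"
    using A mean_sech_nonneg assms by (auto simp: g2_eq intro!: mult_right_mono)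
  finally show "1 - s + s\<^sup>2 - 16 * s ^ 3 \<le> g2 s" .
qed

section \<open>The primitive of the mean squared error\<close>

definition g2_primitive :: "real \<Rightarrow> real" where
  "g2_primitive t = integral {0..t} g2"

lemma g2_integrable_on: "0 \<le> a \<Longrightarrow> g2 integrable_on {a..b}"
  by (intro integrable_continuous_interval continuous_on_subset[OF continuous_on_g2]) auto

lemma integral_g2: "0 \<le> a \<Longrightarrow> a \<le> b \<Longrightarrow> integral {a..b} g2 = g2_primitive b - g2_primitive a"
  unfolding g2_primitive_def
  using Henstock_Kurzweil_Integration.integral_combine[of 0 a b g2] g2_integrable_on[of 0 b] by simp

lemma g2_primitive_0 [simp]: "g2_primitive 0 = 0"
  by (simp add: g2_primitive_def)

lemma has_real_derivative_g2_primitive_within: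
  assumes "0 \<le> t" "t \<le> b"
  shows "(g2_primitive has_real_derivative g2 t) (at t within {0..b})"
  unfolding g2_primitive_def [abs_def] has_real_derivative_iff_has_vector_derivative
  using assms by (intro integral_has_vector_derivative continuous_on_subset[OF continuous_on_g2]) auto

lemma has_real_derivative_g2_primitive:
  assumes "0 < t"
  shows "(g2_primitive has_real_derivative g2 t) (at t)"
proof -
  have "(g2_primitive has_real_derivative g2 t) (at t within {0..t+1})"
    using assms by (intro has_real_derivative_g2_primitive_within) auto
  moreover have "at t within {0..t+1} = at t"
    using assms by (intro at_within_interior) (auto simp: interior_atLeastAtMost_real)
  ultimately show ?thesis
    by simp
qed

lemma g2_primitive_mono:
  assumes "0 \<le> s" "s \<le> t"
  shows "g2_primitive s \<le> g2_primitive t"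
  using integral_g2[OF assms] integral_nonneg[OF g2_integrable_on[of s t]] assms
  by (auto simp: g2_nonneg)

lemma g2_primitive_le: "0 \<le> s \<Longrightarrow> g2_primitive s \<le> s"
  unfolding g2_primitive_def
  using integral_le[OF g2_integrable_on[of 0 s], of "\<lambda>_. 1"] by (auto simp: g2_le_1)

lemma g2_primitive_taylor:
  assumes "0 \<le> s" "s \<le> 1"
  shows g2_primitive_le_cubic: "g2_primitive s \<le> s - s\<^sup>2 / 2 + s ^ 3 / 3"
    and g2_primitive_ge_quartic: "s - s\<^sup>2 / 2 + s ^ 3 / 3 - 4 * s ^ 4 \<le> g2_primitive s"
proof -
  have 1: "((\<lambda>t. 1 - t + t\<^sup>2) has_integral (s - s\<^sup>2 / 2 + s ^ 3 / 3) - (0 - 0\<^sup>2 / 2 + 0 ^ 3 / 3)) {0..s}"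
    by (rule fundamental_theorem_of_calculus)
      (use assms in \<open>auto intro!: derivative_eq_intros
        simp flip: has_real_derivative_iff_has_vector_derivative\<close>)
  have 2: "((\<lambda>t. 1 - t + t\<^sup>2 - 16 * t ^ 3) has_integral
      (s - s\<^sup>2 / 2 + s ^ 3 / 3 - 4 * s ^ 4) - (0 - 0\<^sup>2 / 2 + 0 ^ 3 / 3 - 4 * 0 ^ 4)) {0..s}"
    by (rule fundamental_theorem_of_calculus)
      (use assms in \<open>auto intro!: derivative_eq_intros
        simp flip: has_real_derivative_iff_has_vector_derivative\<close>)
  have g: "(g2 has_integral g2_primitive s) {0..s}"
    unfolding g2_primitive_def by (rule integrable_integral) (rule g2_integrable_on, simp)
  show "g2_primitive s \<le> s - s\<^sup>2 / 2 + s ^ 3 / 3"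
    using has_integral_le[OF g 1] assms g2_le_quadratic by auto
  show "s - s\<^sup>2 / 2 + s ^ 3 / 3 - 4 * s ^ 4 \<le> g2_primitive s"
    using has_integral_le[OF 2 g] assms g2_ge_cubic by auto
qed

subsection \<open>The capacity of the binary-input channel as a primitive of the error function\<close>

text \<open>The conditional entropy, in nats, of the input given the output at SNR \<open>r\<^sup>2\<close>.\<close>

definition log_loss :: "real \<Rightarrow> real" where
  "log_loss r = (\<integral>\<xi>. ln (1 + exp (- 2 * (r\<^sup>2 + \<xi> * r))) \<partial>std_normal_distribution)"

lemma ln_one_plus_square_le: "0 \<le> x \<Longrightarrow> ln (1 + x\<^sup>2) \<le> (x::real)"
proof -
  assume x: "0 \<le> x"
  have "1 + x\<^sup>2 \<le> exp x"
  proof -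
    obtain t where "exp x = (\<Sum>m<4. x ^ m / fact m) + exp t / fact 4 * x ^ 4"
      using Maclaurin_exp_le by blast
    then have "exp x = 1 + x + x\<^sup>2 / 2 + x ^ 3 / 6 + exp t / 24 * x ^ 4"
      by (simp add: eval_nat_numeral)
    moreover have "0 \<le> exp t / 24 * x ^ 4"
      by simp
    moreover have "x + x\<^sup>2 / 2 + x ^ 3 / 6 - x\<^sup>2 = x * ((1 - x / 4)\<^sup>2 + 5 / 48 * x\<^sup>2)"
      by (simp add: power2_eq_square power3_eq_cube field_simps)
    moreover have "0 \<le> x * ((1 - x / 4)\<^sup>2 + 5 / 48 * x\<^sup>2)"
      using x by (intro mult_nonneg_nonneg) auto
    ultimately show ?thesis
      by linarith
  qed
  then show "ln (1 + x\<^sup>2) \<le> x"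
    using ln_le_cancel_iff[of "1 + x\<^sup>2" "exp x"] by (simp add: add_pos_nonneg)
qed

text \<open>The bound exp (-u) is preferred to the obvious exp (-2u): at u = r^2 + \<xi> r the
  latter has Gaussian mean 1 for every r, whereas the former has the decaying mean exp (- r^2 /
  2).\<close>

lemma ln_one_plus_exp_bounds:
  shows ln_one_plus_exp_nonneg: "0 \<le> ln (1 + exp (- 2 * u :: real))"
    and ln_one_plus_exp_le: "ln (1 + exp (- 2 * u)) \<le> exp (- u)"
  using ln_one_plus_square_le[of "exp (- u)"] by (simp_all add: exp_double[symmetric])

lemma std_normal_exp_moment:
  shows integrable_std_normal_exp: "integrable std_normal_distribution (\<lambda>\<xi>. exp (- (r\<^sup>2 + \<xi> * r)))"
    and std_normal_mean_exp: "(\<integral>\<xi>. exp (- (r\<^sup>2 + \<xi> * r)) \<partial>std_normal_distribution) = exp (- r\<^sup>2 / 2)"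
proof -
  have *: "std_normal_density \<xi> * exp (- (r\<^sup>2 + \<xi> * r)) = exp (- r\<^sup>2 / 2) * normal_density (- r) 1 \<xi>" for \<xi>
  proof -
    have "- \<xi>\<^sup>2 / 2 + - (r\<^sup>2 + \<xi> * r) = - r\<^sup>2 / 2 + - (\<xi> + r)\<^sup>2 / 2"
      by (simp add: power2_eq_square field_simps)
    then have "exp (- \<xi>\<^sup>2 / 2) * exp (- (r\<^sup>2 + \<xi> * r)) = exp (- r\<^sup>2 / 2) * exp (- (\<xi> + r)\<^sup>2 / 2)"
      by (metis exp_add)
    then show ?thesis
      by (simp add: normal_density_def)
  qed
  have "integrable lborel (\<lambda>\<xi>. std_normal_density \<xi> * exp (- (r\<^sup>2 + \<xi> * r)))"
    unfolding * by simp
  then show "integrable std_normal_distribution (\<lambda>\<xi>. exp (- (r\<^sup>2 + \<xi> * r)))"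
    by (subst integrable_density) (simp_all add: normal_density_nonneg)
  show "(\<integral>\<xi>. exp (- (r\<^sup>2 + \<xi> * r)) \<partial>std_normal_distribution) = exp (- r\<^sup>2 / 2)"
    by (subst std_normal_expectation_lborel) (simp_all only: *, simp_all)
qed

lemma integrable_log_loss:
  "integrable std_normal_distribution (\<lambda>\<xi>. ln (1 + exp (- 2 * (r\<^sup>2 + \<xi> * r))))"
proof (rule Bochner_Integration.integrable_bound[OF integrable_std_normal_exp[of r]])
  have "norm (ln (1 + exp (- 2 * u))) \<le> norm (exp (- u))" for u :: real
    using ln_one_plus_exp_bounds[of u] by (simp only: real_norm_def abs_of_nonneg abs_exp_cancel)
  then show "AE \<xi> in std_normal_distribution.
      norm (ln (1 + exp (- 2 * (r\<^sup>2 + \<xi> * r)))) \<le> norm (exp (- (r\<^sup>2 + \<xi> * r)))"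
    by (intro AE_I2)
qed measurable

lemma log_loss_nonneg: "0 \<le> log_loss r"
  unfolding log_loss_def by (intro integral_nonneg_AE) (simp del: mult_minus_left add: ln_one_plus_exp_nonneg)

lemma log_loss_le_exp: "log_loss r \<le> exp (- r\<^sup>2 / 2)"
  unfolding log_loss_def std_normal_mean_exp[of r, symmetric]
  by (intro integral_mono integrable_log_loss integrable_std_normal_exp ln_one_plus_exp_le)

text \<open>Symmetrization cancels the odd term \<open>t / \<rho>\<close> below, which replaces the Gaussian integration by
  parts of the usual derivation of the I-MMSE relation.\<close>

lemma mean_derivative_log_loss:
  assumes "\<rho> > 0"
  shows "(\<integral>\<xi>. (1 - tanh (\<rho>\<^sup>2 + \<xi> * \<rho>)) * (2 * \<rho> + \<xi>) \<partial>std_normal_distribution) = \<rho> * g2 (\<rho>\<^sup>2)"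
proof -
  interpret prob_space std_normal_distribution by (rule prob_space_std_normal)
  \<comment> \<open>At t = \<rho>^2 + \<xi> \<rho> the factor t / \<rho> + \<rho> equals 2 \<rho> +
    \<xi>, so the integrand depends on t alone and can be symmetrized.\<close>
  define f where "f t = (1 - tanh t) * (t / \<rho> + \<rho>)" for t :: real
  have f: "f (\<rho>\<^sup>2 + \<xi> * \<rho>) = (1 - tanh (\<rho>\<^sup>2 + \<xi> * \<rho>)) * (2 * \<rho> + \<xi>)" for \<xi>
    unfolding f_def using assms by (simp add: field_simps power2_eq_square)
  have "integrable std_normal_distribution (\<lambda>\<xi>. 4 * \<rho> + 2 * \<bar>\<xi>\<bar>)"
    by (simp add: integrable_std_normal_abs)
  then have int: "integrable std_normal_distribution (\<lambda>\<xi>. f (\<rho>\<^sup>2 + \<xi> * \<rho>))"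
    unfolding f
  proof (rule Bochner_Integration.integrable_bound)
    have "\<bar>(1 - tanh (\<rho>\<^sup>2 + \<xi> * \<rho>)) * (2 * \<rho> + \<xi>)\<bar> \<le> 2 * (2 * \<rho> + \<bar>\<xi>\<bar>)" for \<xi>
      unfolding abs_mult using abs_tanh_le_1[of "\<rho>\<^sup>2 + \<xi> * \<rho>"] assms by (intro mult_mono) auto
    then show "AE \<xi> in std_normal_distribution. norm ((1 - tanh (\<rho>\<^sup>2 + \<xi> * \<rho>)) * (2 * \<rho> + \<xi>)) \<le> norm (4 * \<rho> + 2 * \<bar>\<xi>\<bar>)"
      using assms by (simp add: algebra_simps)
  qed measurable
  have "f \<in> borel_measurable borel"
    unfolding f_def [abs_def] by measurable
  note std_normal_expectation_symmetrize[OF int this]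
  also have "(\<lambda>w. (exp (\<rho> * w) * f (\<rho> * w) + exp (- (\<rho> * w)) * f (- (\<rho> * w))) / 2) =
      (\<lambda>w. \<rho> * (1 / cosh (\<rho> * w)))"
  proof
    fix w
    have e: "exp t * f t = (t / \<rho> + \<rho>) / cosh t" "exp (- t) * f (- t) = (- t / \<rho> + \<rho>) / cosh t" for t
      using exp_minus_inverse[of t]
      by (simp_all add: f_def one_minus_tanh one_plus_tanh mult.commute)
    show "(exp (\<rho> * w) * f (\<rho> * w) + exp (- (\<rho> * w)) * f (- (\<rho> * w))) / 2 = \<rho> * (1 / cosh (\<rho> * w))"
      unfolding e by (simp flip: add_divide_distrib)
  qed
  also have "(\<integral>w. \<rho> * (1 / cosh (\<rho> * w)) \<partial>std_normal_distribution) = \<rho> * mean_sech (\<rho>\<^sup>2)"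
    using assms by (subst integral_mult_right_zero) (simp add: mean_sech_def)
  finally show ?thesis
    unfolding f by (simp add: g2_eq)
qed

lemma has_real_derivative_g2_primitive_nonneg:
  assumes "0 \<le> t"
  shows "(g2_primitive has_real_derivative g2 t) (at t within {0..})"
proof -
  have "at t within {0..} = at t within {0..t + 1}"
    by (rule at_within_nhd[of t "{..<t + 1}"]) auto
  then show ?thesis
    using has_real_derivative_g2_primitive_within[of t "t + 1"] assms by simp
qed

text \<open>At 0 only a one-sided derivative of \<open>g2_primitive\<close> is at hand, but squares
  never leave the nonnegative half-line, so the composition has a two-sided derivative there too.
  This allows integration from 0.\<close>

lemma has_real_derivative_g2_primitive_square:
  "((\<lambda>\<rho>. g2_primitive (\<rho>\<^sup>2) / 2) has_real_derivative \<rho> * g2 (\<rho>\<^sup>2)) (at \<rho>)"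
proof -
  have "(g2_primitive has_real_derivative g2 (\<rho>\<^sup>2)) (at (\<rho>\<^sup>2) within range (\<lambda>\<rho>. \<rho>\<^sup>2))"
    by (rule DERIV_subset[OF has_real_derivative_g2_primitive_nonneg]) auto
  moreover have "((\<lambda>\<rho>::real. \<rho>\<^sup>2) has_real_derivative 2 * \<rho>) (at \<rho>)"
    by (auto intro!: derivative_eq_intros)
  ultimately have "(g2_primitive \<circ> (\<lambda>\<rho>. \<rho>\<^sup>2) has_real_derivative g2 (\<rho>\<^sup>2) * (2 * \<rho>)) (at \<rho>)"
    by (rule DERIV_image_chain)
  from DERIV_cdivide[OF this, of 2] show ?thesis
    by (simp add: o_def mult.commute)
qed

text \<open>For fixed noise the integrand is the \<rho>-derivative of
  \<open>- ln (1 + exp (- 2 * (\<rho>\<^sup>2 + \<xi> * \<rho>)))\<close>, whose value at \<rho> = 0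
  is -ln 2.\<close>

lemma log_loss_integrand_FTC:
  fixes r \<xi> :: real
  assumes "0 \<le> r"
  shows "(\<integral>\<rho>. (1 - tanh (\<rho>\<^sup>2 + \<xi> * \<rho>)) * (2 * \<rho> + \<xi>) * indicator {0..r} \<rho> \<partial>lborel) =
    ln 2 - ln (1 + exp (- 2 * (r\<^sup>2 + \<xi> * r)))"
proof -
  let ?F = "\<lambda>\<rho>. - ln (1 + exp (- 2 * (\<rho>\<^sup>2 + \<xi> * \<rho>)))"
  have "(?F has_real_derivative (1 - tanh (\<rho>\<^sup>2 + \<xi> * \<rho>)) * (2 * \<rho> + \<xi>)) (at \<rho>)" for \<rho>
  proof -
    have *: "1 - tanh u = 2 * exp (- 2 * u) / (1 + exp (- 2 * u))" for u :: real
    proof -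
      have "1 + exp (- 2 * u) \<noteq> 0"
        using exp_gt_zero[of "- 2 * u"] by linarith
      then show ?thesis
        unfolding tanh_real_altdef by (simp add: field_simps)
    qed
    define E where "E = (\<lambda>\<rho>. 1 + exp (- 2 * (\<rho>\<^sup>2 + \<xi> * \<rho>)))"
    define D where "D = exp (- 2 * (\<rho>\<^sup>2 + \<xi> * \<rho>)) * (- 2 * (2 * \<rho> + \<xi>))"
    have "(E has_real_derivative D) (at \<rho>)"
      unfolding E_def D_def by (auto intro!: derivative_eq_intros simp: algebra_simps)
    moreover have "0 < E \<rho>"
      by (simp add: E_def add_pos_pos)
    ultimately have "((\<lambda>\<rho>. - ln (E \<rho>)) has_real_derivative - (D / E \<rho>)) (at \<rho>)"
      by (auto intro!: derivative_eq_intros)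
    moreover have "- (e * (- 2 * d) / (1 + e)) = 2 * e / (1 + e) * d" for e d :: real
      by simp
    ultimately show ?thesis
      unfolding * E_def D_def by (simp only:)
  qed
  then have "(\<integral>\<rho>. (1 - tanh (\<rho>\<^sup>2 + \<xi> * \<rho>)) * (2 * \<rho> + \<xi>) * indicator {0..r} \<rho> \<partial>lborel) = ?F r - ?F 0"
    using assms by (intro integral_FTC_Icc_real) (auto intro!: continuous_intros)
  then show ?thesis
    by simp
qed

text \<open>The I-MMSE relation in integrated form. For each noise value the loss is written as an
  integral over \<rho> from 0 to r; exchanging this with the Gaussian mean leaves the integral of
  \<open>\<rho> * g2 (\<rho>\<^sup>2)\<close>.\<close>

lemma log_loss_eq:
  assumes "0 \<le> r"
  shows "ln 2 - log_loss r = g2_primitive (r\<^sup>2) / 2"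
proof -
  interpret N: prob_space std_normal_distribution by (rule prob_space_std_normal)
  interpret P: pair_sigma_finite lborel std_normal_distribution ..
  define k where "k \<rho> \<xi> = (1 - tanh (\<rho>\<^sup>2 + \<xi> * \<rho>)) * (2 * \<rho> + \<xi>) * indicator {0..r} \<rho>" for \<rho> \<xi> :: real
  have [measurable]: "case_prod k \<in> borel_measurable (lborel \<Otimes>\<^sub>M std_normal_distribution)"
    unfolding k_def [abs_def] by measurable
  \<comment> \<open>The dominating function for Fubini: |1 - tanh| is at most 2, and the Gaussian
    has a finite first absolute moment.\<close>
  have kb: "\<bar>k \<rho> \<xi>\<bar> \<le> (4 * r + 2 * \<bar>\<xi>\<bar>) * indicator {0..r} \<rho>" for \<rho> \<xi>
  proof (cases "\<rho> \<in> {0..r}")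
    case True
    have "\<bar>(1 - tanh (\<rho>\<^sup>2 + \<xi> * \<rho>)) * (2 * \<rho> + \<xi>)\<bar> \<le> 2 * (2 * r + \<bar>\<xi>\<bar>)"
      unfolding abs_mult using abs_tanh_le_1[of "\<rho>\<^sup>2 + \<xi> * \<rho>"] True by (intro mult_mono) auto
    then show ?thesis
      using True by (simp add: k_def)
  qed (simp add: k_def)
  have int_b: "integrable std_normal_distribution (\<lambda>\<xi>. (4 * r + 2 * \<bar>\<xi>\<bar>) * indicator {0..r} \<rho>)" for \<rho>
    by (simp add: integrable_std_normal_abs)
  have int_k: "integrable std_normal_distribution (k \<rho>)" for \<rho>
  proof (rule Bochner_Integration.integrable_bound[OF int_b[of \<rho>]])
    show "k \<rho> \<in> borel_measurable std_normal_distribution"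
      unfolding k_def [abs_def] by measurable
  qed (use kb order_trans[OF kb abs_ge_self] in auto)
  have "integrable (lborel \<Otimes>\<^sub>M std_normal_distribution) (case_prod k)"
  proof (rule P.Fubini_integrable)
    have "integrable lborel (\<lambda>\<rho>. (4 * r + 2) * indicator {0..r} \<rho>)"
      by (intro integrable_mult_right) (simp add: emeasure_lborel_Icc_eq)
    then show "integrable lborel (\<lambda>\<rho>. \<integral>\<xi>. norm (case (\<rho>, \<xi>) of (x, y) \<Rightarrow> k x y) \<partial>std_normal_distribution)"
    proof (rule Bochner_Integration.integrable_bound)
      have "(\<integral>\<xi>. \<bar>k \<rho> \<xi>\<bar> \<partial>std_normal_distribution) \<le> (4 * r + 2) * indicator {0..r} \<rho>" for \<rho>
      proof -
        have "(\<integral>\<xi>. \<bar>k \<rho> \<xi>\<bar> \<partial>std_normal_distribution) \<le>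
            (\<integral>\<xi>. (4 * r + 2 * \<bar>\<xi>\<bar>) * indicator {0..r} \<rho> \<partial>std_normal_distribution)"
          using int_b int_k kb by (intro integral_mono) auto
        also have "\<dots> = (4 * r + 2 * (\<integral>\<xi>. \<bar>\<xi>\<bar> \<partial>std_normal_distribution)) * indicator {0..r} \<rho>"
          using N.prob_space by (simp add: integrable_std_normal_abs)
        also have "\<dots> \<le> (4 * r + 2) * indicator {0..r} \<rho>"
          using std_normal_mean_abs_le_1 by (intro mult_right_mono) auto
        finally show ?thesis .
      qed
      then show "AE \<rho> in lborel. norm (\<integral>\<xi>. norm (case (\<rho>, \<xi>) of (x, y) \<Rightarrow> k x y) \<partial>std_normal_distribution)
          \<le> norm ((4 * r + 2) * indicator {0..r} \<rho>)"
        using assms by (intro AE_I2) (simp add: abs_mult)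
    qed measurable
  qed (auto intro: int_k)
  from P.Fubini_integral[OF this]
  have "(\<integral>\<xi>. (\<integral>\<rho>. k \<rho> \<xi> \<partial>lborel) \<partial>std_normal_distribution) =
      (\<integral>\<rho>. (\<integral>\<xi>. k \<rho> \<xi> \<partial>std_normal_distribution) \<partial>lborel)" .
  also have "(\<integral>\<xi>. (\<integral>\<rho>. k \<rho> \<xi> \<partial>lborel) \<partial>std_normal_distribution) = ln 2 - log_loss r"
    unfolding k_def log_loss_integrand_FTC[OF assms] log_loss_def
    using N.prob_space by (subst Bochner_Integration.integral_diff[OF _ integrable_log_loss]) auto
  also have "(\<integral>\<rho>. (\<integral>\<xi>. k \<rho> \<xi> \<partial>std_normal_distribution) \<partial>lborel) =
      (\<integral>\<rho>. \<rho> * g2 (\<rho>\<^sup>2) * indicator {0..r} \<rho> \<partial>lborel)"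
  proof (rule integral_cong_AE)
    \<comment> \<open>The formula for the inner mean was derived for \<rho> > 0 only; the single
      point 0 is a null set, and negative \<rho> are removed by the indicator.\<close>
    show "AE \<rho> in lborel. (\<integral>\<xi>. k \<rho> \<xi> \<partial>std_normal_distribution) = \<rho> * g2 (\<rho>\<^sup>2) * indicator {0..r} \<rho>"
      using AE_lborel_singleton[of 0]
    proof eventually_elim
      case (elim \<rho>)
      show ?case
        using mean_derivative_log_loss[of \<rho>] elim by (cases "\<rho> > 0") (auto simp: k_def)
    qed
    have "continuous_on UNIV (\<lambda>\<rho>. g2 (\<rho>\<^sup>2))"
      by (rule continuous_on_compose2[OF continuous_on_g2]) (auto intro!: continuous_intros)
    then have [measurable]: "(\<lambda>\<rho>. g2 (\<rho>\<^sup>2)) \<in> borel_measurable borel"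
      by (rule borel_measurable_continuous_onI)
    show "(\<lambda>\<rho>. \<rho> * g2 (\<rho>\<^sup>2) * indicator {0..r} \<rho>) \<in> borel_measurable lborel"
      by measurable
  qed measurable
  also have "\<dots> = g2_primitive (r\<^sup>2) / 2 - g2_primitive (0\<^sup>2) / 2"
  proof (rule integral_FTC_Icc_real[OF assms has_real_derivative_g2_primitive_square])
    have "continuous_on UNIV (\<lambda>\<rho>. \<rho> * g2 (\<rho>\<^sup>2))"
      by (intro continuous_intros continuous_on_compose2[OF continuous_on_g2]) auto
    then show "isCont (\<lambda>\<rho>. \<rho> * g2 (\<rho>\<^sup>2)) x" for x
      by (simp add: continuous_on_eq_continuous_at)
  qed
  finally show ?thesis
    by simp
qed

section \<open>Mutual information of the binary-input Gaussian channel\<close>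

lemma sets_biawgn_space [measurable_cong]:
  "sets biawgn_space = sets (count_space {-1, 1} \<Otimes>\<^sub>M lborel)"
  unfolding biawgn_space_def uniform_count_measure_def by (intro sets_pair_measure_cong) (auto simp: sets_point_measure)

text \<open>Given the input x, the output is Gaussian with mean r x; the factor 1/2 is the
  probability of x. The two measures agree on each measurable set after the translation y = r x + z
  in every slice.\<close>

lemma distributed_biawgn:
  fixes r :: real
  shows "distributed biawgn_space (count_space {-1, 1} \<Otimes>\<^sub>M lborel)
    (\<lambda>p. ((\<lambda>(x, z). x) p, (\<lambda>(x, z). r * x + z) p))
    (\<lambda>p. ennreal (std_normal_density (snd p - r * fst p) / 2))"
proof -
  let ?S = "count_space {-1, 1 :: real}" and ?N = std_normal_distribution
  let ?g = "\<lambda>p. ((\<lambda>(x, z). x) p, (\<lambda>(x, z). r * x + z) p)"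
  let ?d = "\<lambda>p. ennreal (std_normal_density (snd p - r * fst p) / 2)"
  interpret N: prob_space ?N by (rule prob_space_std_normal)
  have id: "(\<lambda>x. x) \<in> borel_measurable ?S"
    by simp
  have fst_borel [measurable]: "fst \<in> borel_measurable (?S \<Otimes>\<^sub>M (lborel :: real measure))"
    using measurable_compose[OF measurable_fst id] .
  have d [measurable]: "?d \<in> borel_measurable (?S \<Otimes>\<^sub>M lborel)"
    by measurable
  have g [measurable]: "?g \<in> measurable biawgn_space (?S \<Otimes>\<^sub>M lborel)"
  proof (rule measurable_Pair)
    show "(\<lambda>(x, z). x) \<in> measurable biawgn_space ?S"
      by (subst measurable_cong_sets[OF sets_biawgn_space refl]) measurable
    show "(\<lambda>(x, z). r * x + z) \<in> measurable biawgn_space lborel"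
      by (subst measurable_cong_sets[OF sets_biawgn_space refl]) (simp add: case_prod_beta, measurable)
  qed
  have "distr biawgn_space (?S \<Otimes>\<^sub>M lborel) ?g = density (?S \<Otimes>\<^sub>M lborel) ?d"
  proof (rule measure_eqI)
    fix A assume "A \<in> sets (distr biawgn_space (?S \<Otimes>\<^sub>M lborel) ?g)"
    then have A [measurable]: "A \<in> sets (?S \<Otimes>\<^sub>M lborel)"
      by simp
    define h where "h x y = (indicator A (x, y) :: ennreal)" for x y
    have h [measurable]: "h x \<in> borel_measurable borel" for x
    proof -
      have "Pair x -` A \<in> sets borel"
        using sets_Pair1[OF A, of x] by simp
      moreover have "h x = indicator (Pair x -` A)"
        by (auto simp: h_def fun_eq_iff indicator_def)
      ultimately show ?thesis
        by simp
    qed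
    have "emeasure (distr biawgn_space (?S \<Otimes>\<^sub>M lborel) ?g) A =
        (\<integral>\<^sup>+p. indicator A p \<partial>distr biawgn_space (?S \<Otimes>\<^sub>M lborel) ?g)"
      by simp
    also have "\<dots> = (\<integral>\<^sup>+p. indicator A (?g p) \<partial>biawgn_space)"
      by (subst nn_integral_distr) auto
    also have "\<dots> = (\<integral>\<^sup>+x. \<integral>\<^sup>+z. indicator A (?g (x, z)) \<partial>?N \<partial>uniform_count_measure {-1, 1})"
      unfolding biawgn_space_def
      by (subst N.nn_integral_fst) (auto simp flip: biawgn_space_def)
    also have "\<dots> = (\<Sum>x\<in>{-1, 1}. ennreal (1 / 2) * (\<integral>\<^sup>+z. h x (r * x + z) \<partial>?N))"
      unfolding uniform_count_measure_def h_def
      by (subst nn_integral_point_measure_finite) simp_all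
    also have "\<dots> = (\<Sum>x\<in>{-1, 1}. \<integral>\<^sup>+y. ?d (x, y) * h x y \<partial>lborel)"
    proof (rule sum.cong[OF refl])
      fix x :: real
      have "(\<integral>\<^sup>+y. ?d (x, y) * h x y \<partial>lborel) =
          ennreal \<bar>1\<bar> * (\<integral>\<^sup>+z. ?d (x, r * x + 1 * z) * h x (r * x + 1 * z) \<partial>lborel)"
        by (rule nn_integral_real_affine) simp_all
      also have "\<dots> = (\<integral>\<^sup>+z. ?d (x, r * x + z) * h x (r * x + z) \<partial>lborel)"
        by simp
      also have "\<dots> = (\<integral>\<^sup>+z. ennreal (1 / 2) * (ennreal (std_normal_density z) * h x (r * x + z)) \<partial>lborel)"
      proof (intro nn_integral_cong)
        fix z :: real
        have "ennreal (std_normal_density z / 2) = ennreal (1 / 2) * ennreal (std_normal_density z)"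
          by (subst ennreal_mult''[symmetric]) simp_all
        then show "?d (x, r * x + z) * h x (r * x + z) =
            ennreal (1 / 2) * (ennreal (std_normal_density z) * h x (r * x + z))"
          by (simp add: mult.assoc)
      qed
      also have "\<dots> = ennreal (1 / 2) * (\<integral>\<^sup>+z. ennreal (std_normal_density z) * h x (r * x + z) \<partial>lborel)"
        by (rule nn_integral_cmult) measurable
      also have "(\<integral>\<^sup>+z. ennreal (std_normal_density z) * h x (r * x + z) \<partial>lborel) =
          (\<integral>\<^sup>+z. h x (r * x + z) \<partial>?N)"
        by (rule nn_integral_density[symmetric]) measurable
      finally show "ennreal (1 / 2) * (\<integral>\<^sup>+z. h x (r * x + z) \<partial>?N) = (\<integral>\<^sup>+y. ?d (x, y) * h x y \<partial>lborel)" ..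
    qed
    also have "\<dots> = (\<integral>\<^sup>+x. \<integral>\<^sup>+y. ?d (x, y) * indicator A (x, y) \<partial>lborel \<partial>?S)"
      by (simp add: nn_integral_count_space_finite h_def)
    also have "\<dots> = (\<integral>\<^sup>+p. ?d p * indicator A p \<partial>(?S \<Otimes>\<^sub>M lborel))"
      by (rule lborel.nn_integral_fst) measurable
    also have "\<dots> = emeasure (density (?S \<Otimes>\<^sub>M lborel) ?d) A"
      by (rule emeasure_density[symmetric]) measurable
    finally show "emeasure (distr biawgn_space (?S \<Otimes>\<^sub>M lborel) ?g) A = emeasure (density (?S \<Otimes>\<^sub>M lborel) ?d) A" .
  qed simp
  then show ?thesis
    unfolding distributed_def using d g by blast
qed

lemma std_normal_density_minus [simp]: "std_normal_density (- z) = std_normal_density z"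
  by (simp add: std_normal_density_def)

lemma integral_std_normal_shift:
  shows "integrable lborel (\<lambda>z. std_normal_density (z - m))"
    and "(\<integral>z. std_normal_density (z - m) \<partial>lborel) = 1"
proof -
  have "(\<lambda>z. std_normal_density (z - m)) = normal_density m 1"
    by (simp add: fun_eq_iff normal_density_def)
  then show "integrable lborel (\<lambda>z. std_normal_density (z - m))"
    "(\<integral>z. std_normal_density (z - m) \<partial>lborel) = 1"
    by simp_all
qed

text \<open>In terms of the noise z for the transmitted symbol, z + 2 r is the noise that the
  opposite symbol would require, up to sign. The ratio of the two Gaussian densities is exp (-2 (r^2
  + z r)), so the likelihood ratio is 2 / (1 + exp (-2 (r^2 + z r))).\<close>

lemma log_likelihood_ratio:
  fixes r z :: real
  shows "log 2 (std_normal_density z / 2 / (1 / 2 * ((std_normal_density z + std_normal_density (z + 2 * r)) / 2))) =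
    1 - ln (1 + exp (- 2 * (r\<^sup>2 + z * r))) / ln 2"
proof -
  have "- (z + 2 * r)\<^sup>2 / 2 = - z\<^sup>2 / 2 + (- 2 * (r\<^sup>2 + z * r))"
    by (simp add: power2_eq_square field_simps)
  then have *: "std_normal_density (z + 2 * r) = std_normal_density z * exp (- 2 * (r\<^sup>2 + z * r))"
    unfolding std_normal_density_def by (simp only: exp_add mult.assoc)
  have pos: "0 < std_normal_density z" "0 < 1 + exp (- 2 * (r\<^sup>2 + z * r))"
    by (simp_all add: normal_density_pos add_pos_pos)
  have "d / 2 / (1 / 2 * ((d + d * e) / 2)) = 2 / (1 + e)" if "0 < d" "0 < 1 + e" for d e :: real
  proof -
    define q where "q = 1 + e"
    have "d / 2 / (1 / 2 * (d * q / 2)) = 2 / q"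
      using that by (simp add: q_def[symmetric] field_simps)
    then show ?thesis
      by (simp add: q_def distrib_left)
  qed
  from this[OF pos] show ?thesis
    unfolding * using pos(2) by (simp add: log_def ln_div diff_divide_distrib)
qed

text \<open>The one bit of input entropy minus the conditional entropy. Both inputs contribute
  equally by the symmetry of the noise, each half of the total.\<close>

lemma biawgn_capacity_eq_log_loss:
  "biawgn_capacity \<gamma> = 1 - log_loss (sqrt \<gamma>) / ln 2"
proof -
  define r where "r = sqrt \<gamma>"
  let ?S = "count_space {-1, 1 :: real}" and ?T = "lborel :: real measure" and ?N = std_normal_distribution
  let ?X = "\<lambda>(x, z). x" and ?Y = "\<lambda>(x, z). r * x + z"
  define Pxy where "Pxy p = std_normal_density (snd p - r * fst p) / 2" for p :: "real \<times> real"
  define Px where "Px x = (1 / 2 :: real)" for x :: real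
  define Py where "Py y = (std_normal_density (y + r) + std_normal_density (y - r)) / 2" for y :: real
  interpret I: prob_space biawgn_space
    by (rule prob_space_biawgn_space)
  interpret I: information_space biawgn_space 2
    by unfold_locales simp
  interpret N: prob_space ?N by (rule prob_space_std_normal)
  have S: "sigma_finite_measure ?S" and T: "sigma_finite_measure ?T"
    by (auto intro: sigma_finite_measure_count_space_finite lborel.sigma_finite_measure_axioms)
  interpret ST: pair_sigma_finite ?S ?T
    using S T by (rule pair_sigma_finite.intro)
  have XY: "distributed biawgn_space (?S \<Otimes>\<^sub>M ?T) (\<lambda>p. (?X p, ?Y p)) Pxy"
    using distributed_biawgn[of r] unfolding Pxy_def .
  have X: "distributed biawgn_space ?S ?X Px"
  proof -
    have "(\<integral>\<^sup>+z. ennreal (Pxy (x, z)) \<partial>?T) = ennreal (Px x)" for x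
      unfolding Pxy_def Px_def
      by (subst nn_integral_eq_integral) (auto simp: integral_std_normal_shift)
    with I.distr_marginal1[OF S T XY] show ?thesis
      by simp
  qed
  have Y: "distributed biawgn_space ?T ?Y Py"
  proof -
    have "(\<integral>\<^sup>+x. ennreal (Pxy (x, y)) \<partial>?S) = ennreal (Py y)" for y
      unfolding Pxy_def Py_def
      by (subst nn_integral_count_space_finite) (auto simp: add_divide_distrib)
    with I.distr_marginal2[OF S T XY] show ?thesis
      by simp
  qed
  define f where "f = (\<lambda>p. Pxy p * log 2 (Pxy p / (Px (fst p) * Py (snd p))))"
  have "biawgn_capacity \<gamma> = integral\<^sup>L (?S \<Otimes>\<^sub>M ?T) f"
    unfolding biawgn_capacity_def f_def r_def[symmetric]
    using X Y XY by (intro I.mutual_information_distr S T) (auto simp: Px_def Py_def Pxy_def)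
  define h where "h z = std_normal_density z * ((1 - ln (1 + exp (- 2 * (r\<^sup>2 + z * r))) / ln 2) / 2)" for z
  \<comment> \<open>The noise is written as x z instead of z. Its law is symmetric, and with this
    sign both inputs lead to the same function of z.\<close>
  have f: "f (x, r * x + x * z) = h z" if "x \<in> {-1, 1}" for x z
  proof -
    have "std_normal_density (r * x + x * z + r) + std_normal_density (r * x + x * z - r) =
        std_normal_density z + std_normal_density (z + 2 * r)"
      "std_normal_density (r * x + x * z - r * x) = std_normal_density z"
      using that std_normal_density_minus[of "z + 2 * r"] by (auto simp: algebra_simps)
    then show ?thesis
      unfolding f_def Pxy_def Px_def Py_def h_def fst_conv snd_conv
      using log_likelihood_ratio[of z r] by simp
  qed
  have int: "integrable ?N (\<lambda>z. (1 - ln (1 + exp (- 2 * (r\<^sup>2 + z * r))) / ln 2) / 2)"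
    by (intro integrable_divide Bochner_Integration.integrable_diff integrable_log_loss) auto
  then have int_h: "integrable lborel h"
    unfolding h_def by (subst (asm) integrable_density) auto
  have h: "integral\<^sup>L lborel h = (1 - log_loss r / ln 2) / 2"
  proof -
    have "integral\<^sup>L lborel h = (\<integral>z. (1 - ln (1 + exp (- 2 * (r\<^sup>2 + z * r))) / ln 2) / 2 \<partial>?N)"
      unfolding h_def by (subst std_normal_expectation_lborel) auto
    also have "\<dots> = (1 - log_loss r / ln 2) / 2"
      unfolding log_loss_def using N.prob_space integrable_log_loss[of r]
      by (simp del: mult_minus_left)
    finally show ?thesis .
  qed
  have slice: "integrable lborel (\<lambda>y. f (x, y))" "(\<integral>y. f (x, y) \<partial>lborel) = (1 - log_loss r / ln 2) / 2"
    if x: "x \<in> {-1, 1}" for x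
  proof -
    have "x \<noteq> 0" "\<bar>x\<bar> = 1"
      using x by auto
    with int_h h show "integrable lborel (\<lambda>y. f (x, y))" "(\<integral>y. f (x, y) \<partial>lborel) = (1 - log_loss r / ln 2) / 2"
      using lborel_integrable_real_affine_iff[of x "\<lambda>y. f (x, y)" "r * x"]
        lborel_integral_real_affine[of x "\<lambda>y. f (x, y)" "r * x"] by (simp_all add: f[OF x])
  qed
  have "integrable (?S \<Otimes>\<^sub>M ?T) f"
  proof (rule ST.Fubini_integrable)
    have id: "(\<lambda>x. x) \<in> borel_measurable ?S"
      by simp
    have [measurable]: "fst \<in> borel_measurable (?S \<Otimes>\<^sub>M ?T)"
      using measurable_compose[OF measurable_fst id] .
    show "f \<in> borel_measurable (?S \<Otimes>\<^sub>M ?T)"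
      unfolding f_def Pxy_def Px_def Py_def by measurable
    show "AE x in ?S. integrable ?T (\<lambda>y. f (x, y))"
      using slice(1) by (simp add: AE_count_space)
  qed (rule integrable_count_space, simp)
  from ST.integral_fst'[OF this] have "integral\<^sup>L (?S \<Otimes>\<^sub>M ?T) f = (\<integral>x. (\<integral>y. f (x, y) \<partial>?T) \<partial>?S)" ..
  also have "\<dots> = 1 - log_loss r / ln 2"
    by (subst lebesgue_integral_count_space_finite) (simp_all add: slice(2))
  finally show ?thesis
    using \<open>biawgn_capacity \<gamma> = integral\<^sup>L (?S \<Otimes>\<^sub>M ?T) f\<close> by (simp add: r_def)
qed

lemma biawgn_capacity_eq:
  assumes "0 \<le> \<gamma>"
  shows "biawgn_capacity \<gamma> = g2_primitive \<gamma> / (2 * ln 2)"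
proof -
  have "biawgn_capacity \<gamma> = (ln 2 - log_loss (sqrt \<gamma>)) / ln 2"
    by (simp add: biawgn_capacity_eq_log_loss diff_divide_distrib)
  then show ?thesis
    using log_loss_eq[of "sqrt \<gamma>"] assms by simp
qed

text \<open>The capacity never exceeds one bit, and falls short of it by an exponentially small
  amount at high SNR.\<close>

lemma g2_primitive_bounds:
  assumes "0 \<le> s"
  shows g2_primitive_le_2ln2: "g2_primitive s \<le> 2 * ln 2"
    and g2_primitive_ge_2ln2: "2 * ln 2 - 2 * exp (- s / 2) \<le> g2_primitive s"
  using log_loss_eq[of "sqrt s"] log_loss_nonneg[of "sqrt s"] log_loss_le_exp[of "sqrt s"] assms
  by simp_all

subsection \<open>The landscape whose critical points solve the characteristic equation\<close>

definition landscape :: "real \<Rightarrow> real \<Rightarrow> real \<Rightarrow> real" where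
  "landscape a v y = ln y + v / y + a * g2_primitive (1 / (a * y))"

lemma char_solution_bounds:
  assumes "a > 0" "char_solution a v x"
  shows "v \<le> x" "x \<le> 1 + v"
proof -
  have "0 \<le> 1 / (a * x)" "x = g2 (1 / (a * x)) + v"
    using assms by (auto simp: char_solution_def)
  then show "v \<le> x" "x \<le> 1 + v"
    using g2_nonneg[of "1 / (a * x)"] g2_le_1[of "1 / (a * x)"] by linarith+
qed

lemma continuous_on_g2_snr:
  assumes "a > 0" "S \<subseteq> {0<..}"
  shows "continuous_on S (\<lambda>x. g2 (1 / (a * x)))"
  using assms by (intro continuous_on_compose2[OF continuous_on_g2] continuous_intros) auto

lemma char_solution_between:
  assumes "a > 0" "0 < lo" "lo \<le> hi"
    and "lo \<le> g2 (1 / (a * lo)) + v" "g2 (1 / (a * hi)) + v \<le> hi"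
  shows "\<exists>x. lo \<le> x \<and> x \<le> hi \<and> char_solution a v x"
proof -
  have "continuous_on {lo..hi} (\<lambda>x. x - g2 (1 / (a * x)))"
    using assms by (intro continuous_intros continuous_on_g2_snr) auto
  then have "\<exists>x. lo \<le> x \<and> x \<le> hi \<and> x - g2 (1 / (a * x)) = v"
    using assms by (intro IVT') auto
  then show ?thesis
    using assms by (auto simp: char_solution_def algebra_simps)
qed

lemma compact_char_solutions:
  assumes "a > 0" "v > 0"
  shows "compact {x. char_solution a v x}" "{x. char_solution a v x} \<noteq> {}"
proof -
  have "{x. char_solution a v x} = {x \<in> {v..1 + v}. x - g2 (1 / (a * x)) = v}"
    using assms char_solution_bounds[OF assms(1), of v] by (auto simp: char_solution_def algebra_simps)
  moreover have "closed {x \<in> {v..1 + v}. x - g2 (1 / (a * x)) = v}"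
    using assms by (intro continuous_closed_preimage_constant continuous_intros continuous_on_g2_snr) auto
  moreover have "bounded {x \<in> {v..1 + v}. x - g2 (1 / (a * x)) = v}"
    by (rule bounded_subset[OF bounded_closed_interval[of v "1 + v"]]) auto
  ultimately show "compact {x. char_solution a v x}"
    by (simp add: compact_eq_bounded_closed)
  have "\<exists>x. v \<le> x \<and> x \<le> 1 + v \<and> char_solution a v x"
    using assms g2_nonneg[of "1 / (a * v)"] g2_le_1[of "1 / (a * (1 + v))"]
    by (intro char_solution_between) auto
  then show "{x. char_solution a v x} \<noteq> {}"
    by auto
qed

text \<open>Compactness and nonemptiness of the solution set provide a least and a greatest element,
  without which \<open>x1\<close> and \<open>x3\<close> would carry no information.\<close>

lemma
  assumes "a > 0" "v > 0"
  shows char_solution_x1: "char_solution a v (x1 a v)"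
    and x1_le: "\<And>x. char_solution a v x \<Longrightarrow> x1 a v \<le> x"
    and char_solution_x3: "char_solution a v (x3 a v)"
    and le_x3: "\<And>x. char_solution a v x \<Longrightarrow> x \<le> x3 a v"
proof -
  obtain m where m: "char_solution a v m" "\<And>x. char_solution a v x \<Longrightarrow> m \<le> x"
    using compact_attains_inf[OF compact_char_solutions[OF assms]] by auto
  then have "x1 a v = m"
    unfolding x1_def by (intro Least_equality)
  with m show "char_solution a v (x1 a v)" "\<And>x. char_solution a v x \<Longrightarrow> x1 a v \<le> x"
    by auto
  obtain M where M: "char_solution a v M" "\<And>x. char_solution a v x \<Longrightarrow> x \<le> M"
    using compact_attains_sup[OF compact_char_solutions[OF assms]] by auto
  then have "x3 a v = M"
    unfolding x3_def by (intro Greatest_equality)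
  with M show "char_solution a v (x3 a v)" "\<And>x. char_solution a v x \<Longrightarrow> x \<le> x3 a v"
    by auto
qed

lemma x1_bounds:
  assumes "a > 0" "v > 0"
  shows "v \<le> x1 a v" "x1 a v \<le> 1 + v" "0 < x1 a v" "x1 a v = g2 (1 / (a * x1 a v)) + v"
  using char_solution_x1[OF assms] char_solution_bounds[OF assms(1) char_solution_x1[OF assms]]
  unfolding char_solution_def by auto

text \<open>If the sign were positive at y, then y > v, and the intermediate value theorem would
  give a solution in [v, y]. Minimality of \<open>x1\<close> then forces y = \<open>x1\<close>,
  where the expression vanishes. Since this expression carries the sign of the derivative of the
  landscape, the landscape decreases up to \<open>x1\<close>.\<close>

lemma below_x1:
  assumes "a > 0" "v > 0" "0 < y" "y \<le> x1 a v"
  shows "y - v - g2 (1 / (a * y)) \<le> 0"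
proof (rule ccontr)
  assume *: "\<not> y - v - g2 (1 / (a * y)) \<le> 0"
  have "0 \<le> g2 (1 / (a * y))" "0 \<le> g2 (1 / (a * v))"
    using assms by (auto intro!: g2_nonneg)
  with * assms obtain x where "x \<le> y" "char_solution a v x"
    using char_solution_between[of a v y v] by auto
  then have "y = x1 a v"
    using x1_le[OF assms(1,2)] assms(4) by force
  then have "y - v - g2 (1 / (a * y)) = 0"
    using x1_bounds(4)[OF assms(1,2)] by simp
  with * show False
    by simp
qed

lemma has_real_derivative_landscape:
  assumes "a > 0" "y > 0"
  shows "(landscape a v has_real_derivative (y - v - g2 (1 / (a * y))) / y\<^sup>2) (at y)"
proof -
  have "((\<lambda>y. 1 / (a * y)) has_real_derivative - 1 / (a * y\<^sup>2)) (at y)"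
    using assms by (auto intro!: derivative_eq_intros simp: power2_eq_square)
  moreover have "(g2_primitive has_real_derivative g2 (1 / (a * y))) (at (1 / (a * y)))"
    using assms by (intro has_real_derivative_g2_primitive) simp
  ultimately have "((\<lambda>y. g2_primitive (1 / (a * y))) has_real_derivative
      g2 (1 / (a * y)) * (- 1 / (a * y\<^sup>2))) (at y)"
    by (rule DERIV_chain2[rotated])
  then have "((\<lambda>y. ln y + v / y + a * g2_primitive (1 / (a * y))) has_real_derivative
      1 / y + - v / y\<^sup>2 + a * (g2 (1 / (a * y)) * (- 1 / (a * y\<^sup>2)))) (at y)"
    using assms by (intro DERIV_add DERIV_cmult) (auto intro!: derivative_eq_intros simp: power2_eq_square)
  moreover have "1 / y + - v / y\<^sup>2 + a * (g2 (1 / (a * y)) * (- 1 / (a * y\<^sup>2))) =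
      (y - v - g2 (1 / (a * y))) / y\<^sup>2"
    using assms by (simp add: power2_eq_square diff_divide_distrib)
  ultimately show ?thesis
    by (simp add: landscape_def [abs_def])
qed

lemma landscape_antimono:
  assumes "a > 0" "v > 0" "0 < y" "y \<le> z" "z \<le> x1 a v"
  shows "landscape a v z \<le> landscape a v y"
proof (rule DERIV_nonpos_imp_nonincreasing[OF assms(4)])
  fix x assume x: "y \<le> x" "x \<le> z"
  then have "(x - v - g2 (1 / (a * x))) / x\<^sup>2 \<le> 0"
    using assms below_x1[of a v x] by (intro divide_nonpos_nonneg) auto
  with x assms show "\<exists>d. DERIV (landscape a v) x :> d \<and> d \<le> 0"
    using has_real_derivative_landscape[of a x v] by auto
qed

lemma potential_eq:
  assumes "a > 0" "v > 0" "x \<ge> 0"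
  shows "potential v x a = landscape a v (x + x1 a v) - landscape a v (x1 a v)"
proof -
  have p: "0 < x1 a v"
    using assms x1_bounds by simp
  have i: "integral {1 / (a * (x + x1 a v)) .. 1 / (a * x1 a v)} g2 =
      g2_primitive (1 / (a * x1 a v)) - g2_primitive (1 / (a * (x + x1 a v)))"
    using p assms by (intro integral_g2) (auto intro!: divide_left_mono mult_left_mono mult_pos_pos add_nonneg_pos)
  have q: "v * x / (x1 a v * (x + x1 a v)) = v / x1 a v - v / (x + x1 a v)"
    using p assms by (simp add: field_simps)
  have l: "ln ((x + x1 a v) / x1 a v) = ln (x + x1 a v) - ln (x1 a v)"
    using p assms by (simp add: ln_div)
  show ?thesis
    unfolding potential_def landscape_def i q l by (simp add: algebra_simps)
qed

lemma ln_plus_div_ge: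
  assumes "(v::real) > 0" "x > 0"
  shows "ln v + 1 \<le> ln x + v / x"
  using ln_le_minus_one[of "v / x"] assms by (simp add: ln_div)

text \<open>The quantity on the left is the landscape at \<open>x1\<close> minus ln x + v / x at x =
  \<open>x1\<close>, and the latter is smallest at x = v.\<close>

lemma rate_x1_le:
  assumes "a > 0" "v > 0" "landscape a v (x1 a v) \<le> B"
  shows "a * g2_primitive (1 / (a * x1 a v)) \<le> B - ln v - 1"
  using ln_plus_div_ge[OF assms(2) x1_bounds(3)[OF assms(1,2)]] assms(3)
  unfolding landscape_def by linarith

lemma landscape_x1_le:
  assumes "a > 0" "v > 0"
  shows "landscape a v (x1 a v) \<le> ln v + 1 + 2 * ln 2 * a"
proof -
  have "landscape a v (x1 a v) \<le> landscape a v v"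
    using assms x1_bounds[OF assms] by (intro landscape_antimono) auto
  also have "\<dots> \<le> ln v + 1 + a * (2 * ln 2)"
    unfolding landscape_def using assms by (auto intro!: mult_left_mono g2_primitive_le_2ln2)
  finally show ?thesis
    by (simp add: mult_ac)
qed

section \<open>Upper and lower estimates of the landscape\<close>

text \<open>The difference of the two sides has derivative e^3 / (1 + e), which has the sign of e,
  so 0 is its minimum. Negative e occur below when y exceeds 1.\<close>

lemma ln_add_one_le_cubic:
  fixes e :: real
  assumes "e > - 1"
  shows "ln (1 + e) \<le> e - e\<^sup>2 / 2 + e ^ 3 / 3"
proof -
  define F where "F e = e - e\<^sup>2 / 2 + e ^ 3 / 3 - ln (1 + e)" for e :: real
  have d: "(F has_real_derivative e ^ 3 / (1 + e)) (at e)" if "e > - 1" for e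
    unfolding F_def [abs_def] using that
    by (auto intro!: derivative_eq_intros simp: field_simps power2_eq_square power3_eq_cube)
  have "F 0 \<le> F e"
  proof (cases "e \<ge> 0")
    case True
    show ?thesis
    proof (rule DERIV_nonneg_imp_nondecreasing[OF True])
      fix x :: real assume "0 \<le> x" "x \<le> e"
      then show "\<exists>y. DERIV F x :> y \<and> 0 \<le> y"
        by (intro exI[of _ "x ^ 3 / (1 + x)"] conjI d) auto
    qed
  next
    case False
    then have "e \<le> 0"
      by simp
    show ?thesis
    proof (rule DERIV_nonpos_imp_nonincreasing[OF \<open>e \<le> 0\<close>])
      fix x :: real assume "e \<le> x" "x \<le> 0"
      then show "\<exists>y. DERIV F x :> y \<and> y \<le> 0"
        using assms by (intro exI[of _ "x ^ 3 / (1 + x)"] conjI d) (auto intro!: divide_nonpos_nonneg simp: power3_eq_cube mult_nonpos_nonpos mult_nonneg_nonpos)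
    qed
  qed
  then show ?thesis
    by (simp add: F_def)
qed

lemma ln_add_one_ge_quadratic:
  fixes x :: real
  assumes "0 \<le> x"
  shows "x - x\<^sup>2 / 2 \<le> ln (1 + x)"
proof -
  let ?F = "\<lambda>x::real. ln (1 + x) - (x - x\<^sup>2 / 2)"
  have "?F 0 \<le> ?F x"
  proof (rule DERIV_nonneg_imp_nondecreasing[OF assms])
    fix z :: real assume "0 \<le> z"
    then have "(?F has_real_derivative z\<^sup>2 / (1 + z)) (at z)"
      by (auto intro!: derivative_eq_intros simp: field_simps power2_eq_square)
    with \<open>0 \<le> z\<close> show "\<exists>y. DERIV ?F z :> y \<and> 0 \<le> y"
      by (intro exI[of _ "z\<^sup>2 / (1 + z)"] conjI) auto
  qed
  then show ?thesis
    by simp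
qed

text \<open>With u = 1/a, the stationarity condition y = g2 (u / y) at zero noise suggests y = 1 - u
  to first order. The choice y = 1 / (1 + u) agrees with this, makes the SNR the polynomial u (1 +
  u), and suffices because an error in the minimiser enters quadratically.\<close>

lemma landscape_near_minimum_le:
  assumes "a \<ge> 4" "v \<ge> 0"
  shows "landscape a v (a / (a + 1)) \<le> 1 - 1 / (2 * a) - 1 / (6 * a\<^sup>2) + 2 / a ^ 3 + 2 * v"
proof -
  define u where "u = 1 / a"
  have u: "0 < u" "u \<le> 1 / 4" and a: "a = 1 / u"
    using assms by (auto simp: u_def field_simps)
  define s where "s = u * (1 + u)"
  have s: "0 \<le> s" "s \<le> 1"
    using u mult_mono[of u "1/4" "1 + u" 2] by (auto simp: s_def)
  have y: "a / (a + 1) = 1 / (1 + u)" "1 / (a * (a / (a + 1))) = s"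
    using u by (simp_all add: a s_def field_simps)
  have 1: "ln (a / (a + 1)) \<le> - u + u\<^sup>2 / 2"
  proof -
    have "u - u\<^sup>2 / 2 \<le> ln (1 + u)"
      using u by (intro ln_add_one_ge_quadratic) auto
    then show ?thesis
      unfolding y using u by (simp add: ln_div)
  qed
  have 2: "v / (a / (a + 1)) \<le> 2 * v"
    unfolding y using u assms mult_left_mono[of "1 + u" 2 v] by (simp add: mult.commute)
  have 3: "a * g2_primitive (1 / (a * (a / (a + 1)))) \<le> (1 + u) - u * (1 + u)\<^sup>2 / 2 + u\<^sup>2 * (1 + u) ^ 3 / 3"
  proof -
    have "a * g2_primitive s \<le> a * (s - s\<^sup>2 / 2 + s ^ 3 / 3)"
      using g2_primitive_le_cubic[OF s] assms by (intro mult_left_mono) auto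
    also have "\<dots> = (1 + u) - u * (1 + u)\<^sup>2 / 2 + u\<^sup>2 * (1 + u) ^ 3 / 3"
      unfolding a s_def using u by (simp add: field_simps power2_eq_square power3_eq_cube)
    finally show ?thesis
      unfolding y(2) .
  qed
  have "landscape a v (a / (a + 1)) \<le>
      - u + u\<^sup>2 / 2 + 2 * v + ((1 + u) - u * (1 + u)\<^sup>2 / 2 + u\<^sup>2 * (1 + u) ^ 3 / 3)"
    unfolding landscape_def using 1 2 3 by linarith
  also have "\<dots> = 1 - u / 2 - u\<^sup>2 / 6 + u ^ 3 * (1 / 2 + u + u\<^sup>2 / 3) + 2 * v"
    by (simp add: field_simps eval_nat_numeral)
  also have "\<dots> \<le> 1 - u / 2 - u\<^sup>2 / 6 + u ^ 3 * 2 + 2 * v"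
  proof -
    have "u\<^sup>2 \<le> 1"
      using u by (simp add: power_le_one)
    then have "1 / 2 + u + u\<^sup>2 / 3 \<le> 2"
      using u by linarith
    then show ?thesis
      using u by (simp add: mult_left_mono)
  qed
  finally show ?thesis
    by (simp add: u_def power_divide)
qed

text \<open>The lower counterpart: put 1 / y = 1 + e and expand around e = u = 1/a, the point used
  in the upper bound. Of the constant 66, 64 comes from the quartic error of
  \<open>g2_primitive\<close> with 1 / y at most 2, and 2 from completing a square.\<close>

lemma landscape_ge_near_1:
  assumes "a \<ge> 36" "v \<ge> 0" "1 / 2 \<le> y" "y \<le> 2"
  shows "1 - 1 / (2 * a) - 1 / (6 * a\<^sup>2) - 66 / a ^ 3 \<le> landscape a v y"
proof -
  define u where "u = 1 / a"
  have u: "0 < u" "u \<le> 1 / 36" and a: "a = 1 / u"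
    using assms by (auto simp: u_def field_simps)
  define w where "w = 1 / y"
  have w: "1 / 2 \<le> w" "w \<le> 2" and y: "y = 1 / w"
    using assms by (auto simp: w_def field_simps)
  define e where "e = w - 1"
  have e: "- 1 / 2 \<le> e" "e \<le> 1" and we: "w = 1 + e"
    using w by (auto simp: e_def)
  define s where "s = u * w"
  have s: "0 \<le> s" "s \<le> 1"
    using u w mult_mono[of u "1/36" w 2] by (auto simp: s_def)
  have 1: "- e + e\<^sup>2 / 2 - e ^ 3 / 3 \<le> ln y"
    using ln_add_one_le_cubic[of e] e w by (simp add: y we ln_div)
  have 2: "0 \<le> v / y"
    using assms by simp
  have 3: "w - u * w\<^sup>2 / 2 + u\<^sup>2 * w ^ 3 / 3 - 64 * u ^ 3 \<le> a * g2_primitive (1 / (a * y))"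
  proof -
    have "w ^ 4 \<le> 2 ^ 4"
      using w by (intro power_mono) auto
    then have "4 * w ^ 4 * u ^ 3 \<le> 64 * u ^ 3"
      using u by (intro mult_right_mono) auto
    then have "w - u * w\<^sup>2 / 2 + u\<^sup>2 * w ^ 3 / 3 - 64 * u ^ 3 \<le>
        w - u * w\<^sup>2 / 2 + u\<^sup>2 * w ^ 3 / 3 - 4 * w ^ 4 * u ^ 3"
      by linarith
    also have "\<dots> = a * (s - s\<^sup>2 / 2 + s ^ 3 / 3 - 4 * s ^ 4)"
      unfolding a s_def using u by (simp add: field_simps eval_nat_numeral)
    also have "\<dots> \<le> a * g2_primitive s"
      using g2_primitive_ge_quartic[OF s] assms by (intro mult_left_mono) auto
    also have "s = 1 / (a * y)"
      by (simp add: s_def a y)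
    finally show ?thesis .
  qed
  define f where "f = e - u"
  \<comment> \<open>The cross term - f u^2 is absorbed by one eighth of f^2 through (f - 4 u^2)^2 /
    8, at a cost of 2 u^4, hence at most 2 u^3. The assumption on a keeps the remaining coefficient
    of f^2 above 1/8 even for e near 1.\<close>
  have "0 \<le> f\<^sup>2 * (1 / 6 - 3 / 2 * u - f / 3 + 1 / 3) + (f\<^sup>2 - 8 * (f * u\<^sup>2)) / 8 - f\<^sup>2 / 8 + 2 * u ^ 3"
  proof -
    have "0 \<le> (f - 4 * u\<^sup>2)\<^sup>2 / 8"
      by simp
    also have "\<dots> = (f\<^sup>2 - 8 * (f * u\<^sup>2)) / 8 + 2 * u ^ 3 * u"
      by (simp add: power2_eq_square power3_eq_cube field_simps)
    also have "2 * u ^ 3 * u \<le> 2 * u ^ 3 * 1"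
      using u by (intro mult_left_mono) auto
    finally have "0 \<le> (f\<^sup>2 - 8 * (f * u\<^sup>2)) / 8 + 2 * u ^ 3"
      by simp
    moreover have "1 / 8 \<le> 1 / 6 - 3 / 2 * u - f / 3 + 1 / 3"
      unfolding f_def using u e by (simp add: field_simps)
    then have "f\<^sup>2 * (1 / 8) \<le> f\<^sup>2 * (1 / 6 - 3 / 2 * u - f / 3 + 1 / 3)"
      by (rule mult_left_mono) simp
    moreover have "f\<^sup>2 * (1 / 8) = f\<^sup>2 / 8"
      by simp
    ultimately show ?thesis
      by linarith
  qed
  also have "\<dots> = f\<^sup>2 / 2 - f ^ 3 / 3 - 3 / 2 * u * f\<^sup>2 - f * u\<^sup>2 + 2 * u ^ 3"
    by (simp add: power2_eq_square power3_eq_cube field_simps)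
  finally have f: "0 \<le> f\<^sup>2 / 2 - f ^ 3 / 3 - 3 / 2 * u * f\<^sup>2 - f * u\<^sup>2 + 2 * u ^ 3" .
  have g: "0 \<le> u\<^sup>2 * (e\<^sup>2 * (1 + e / 3)) + u ^ 3 / 6"
  proof -
    have "0 \<le> 1 + e / 3"
      using e by simp
    then have "0 \<le> u\<^sup>2 * (e\<^sup>2 * (1 + e / 3))"
      by (intro mult_nonneg_nonneg zero_le_power2)
    moreover have "0 \<le> u ^ 3"
      using u by simp
    ultimately show ?thesis
      by simp
  qed
  have "(- e + e\<^sup>2 / 2 - e ^ 3 / 3) + (w - u * w\<^sup>2 / 2 + u\<^sup>2 * w ^ 3 / 3 - 64 * u ^ 3)
      - (1 - u / 2 - u\<^sup>2 / 6 - 66 * u ^ 3) =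
      (f\<^sup>2 / 2 - f ^ 3 / 3 - 3 / 2 * u * f\<^sup>2 - f * u\<^sup>2 + 2 * u ^ 3) + (u\<^sup>2 * (e\<^sup>2 * (1 + e / 3)) + u ^ 3 / 6)"
    unfolding we f_def by (simp add: power2_eq_square power3_eq_cube field_simps)
  with f g have "1 - u / 2 - u\<^sup>2 / 6 - 66 * u ^ 3 \<le>
      (- e + e\<^sup>2 / 2 - e ^ 3 / 3) + (w - u * w\<^sup>2 / 2 + u\<^sup>2 * w ^ 3 / 3 - 64 * u ^ 3)"
    by linarith
  also have "\<dots> \<le> landscape a v y"
    unfolding landscape_def using 1 2 3 by linarith
  finally show ?thesis
    by (simp add: u_def power_divide)
qed

lemma g2_primitive_ge_quadratic:
  assumes "0 \<le> s" "s \<le> 1 / 16"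
  shows "s - s\<^sup>2 / 2 \<le> g2_primitive s"
proof -
  have "0 \<le> s ^ 3 * (1 / 3 - 4 * s)"
    using assms by (intro mult_nonneg_nonneg) auto
  also have "\<dots> = s ^ 3 / 3 - 4 * s ^ 4"
    by (simp add: field_simps eval_nat_numeral)
  finally show ?thesis
    using g2_primitive_ge_quartic[of s] assms by simp
qed

text \<open>With w = 1 / y at least 2, the term a G is at least 31/32 w, while ln w is at most its
  tangent at w = 2. The surplus is large enough already at w = 2.\<close>

lemma landscape_ge_1_small_snr:
  assumes "a > 0" "v \<ge> 0" "0 < y" "y \<le> 1 / 2" "1 / (a * y) \<le> 1 / 16"
  shows "1 \<le> landscape a v y"
proof -
  define w where "w = 1 / y"
  have w: "2 \<le> w"
    using assms by (simp add: w_def field_simps)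
  define s where "s = 1 / (a * y)"
  have s: "0 \<le> s" "s \<le> 1 / 16"
    using assms by (auto simp: s_def)
  have "31 / 32 * w = a * (s * (31 / 32))"
    using assms by (simp add: s_def w_def)
  also have "\<dots> \<le> a * (s - s\<^sup>2 / 2)"
  proof -
    have "s * (31 / 32) \<le> s * (1 - s / 2)"
      using s by (intro mult_left_mono) auto
    then show ?thesis
      using assms by (intro mult_left_mono) (auto simp: power2_eq_square right_diff_distrib)
  qed
  also have "\<dots> \<le> a * g2_primitive s"
    using assms g2_primitive_ge_quadratic[OF s] by simp
  finally have 1: "31 / 32 * w \<le> a * g2_primitive (1 / (a * y))"
    by (simp add: s_def)
  have "ln w = ln 2 + ln (w / 2)"
    using w by (simp add: ln_div)
  also have "\<dots> \<le> 25 / 36 + (w / 2 - 1)"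
    using w ln2_le_25_over_36 ln_le_minus_one[of "w / 2"] by simp
  finally have "- (25 / 36 + (w / 2 - 1)) \<le> ln y"
    using assms by (simp add: w_def ln_div)
  moreover have "0 \<le> v / y"
    using assms by simp
  ultimately show ?thesis
    unfolding landscape_def using 1 w by linarith
qed

text \<open>The upper SNR bound says that y is at least 1 / a^2, so the logarithm costs at most 2 ln
  a, against a gain a / 20 from the SNR being at least 1/16. Bounding ln a by 2 sqrt a, the
  comparison holds once sqrt a is at least 100.\<close>

lemma landscape_ge_1_medium_snr:
  assumes "a \<ge> 10000" "v \<ge> 0" "0 < y" "1 / 16 \<le> 1 / (a * y)" "1 / (a * y) \<le> a"
  shows "1 \<le> landscape a v y"
proof -
  have "1 / 20 \<le> g2_primitive (1 / 16)"
    using g2_primitive_ge_quadratic[of "1 / 16"] by (simp add: power2_eq_square)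
  also have "\<dots> \<le> g2_primitive (1 / (a * y))"
    using assms by (intro g2_primitive_mono) auto
  finally have 1: "a / 20 \<le> a * g2_primitive (1 / (a * y))"
    using assms mult_left_mono[of "1 / 20" _ a] by simp
  have "1 / a\<^sup>2 \<le> y"
    using assms by (simp add: field_simps power2_eq_square)
  then have "ln (1 / a\<^sup>2) \<le> ln y"
    using assms by (intro ln_mono) auto
  moreover have "ln (1 / a\<^sup>2) = - (2 * ln a)"
    using assms by (simp add: ln_div ln_realpow)
  moreover have "2 * ln a \<le> 4 * sqrt a"
    using ln_bound[of "sqrt a"] assms by (simp add: ln_sqrt)
  moreover have "4 * sqrt a + 1 \<le> a / 20"
  proof -
    have "sqrt a \<ge> 100"
      using assms real_sqrt_le_mono[of "100\<^sup>2" a] by simp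
    then have "100 * sqrt a \<le> sqrt a * sqrt a"
      by (intro mult_right_mono) linarith+
    moreover have "sqrt a * sqrt a = a"
      using assms by (intro real_sqrt_mult_self[THEN trans]) simp
    ultimately show ?thesis
      using \<open>sqrt a \<ge> 100\<close> by linarith
  qed
  moreover have "0 \<le> v / y"
    using assms by simp
  ultimately show ?thesis
    unfolding landscape_def using 1 by linarith
qed

lemma exp_minus_half_le:
  fixes s :: real
  assumes "s \<ge> 10000"
  shows "exp (- s / 2) \<le> 1 / (2 * s ^ 3)"
proof -
  have "s / 8 \<le> exp (s / 8)"
    using exp_ge_add_one_self[of "s / 8"] by linarith
  then have "(s / 8) ^ 4 \<le> exp (s / 8) ^ 4"
    using assms by (intro power_mono) auto
  also have "\<dots> = exp (s / 2)"
    by (simp flip: exp_of_nat_mult)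
  finally have "s ^ 3 * (s / 4096) \<le> exp (s / 2)"
    by (simp add: power_divide eval_nat_numeral)
  moreover have "s ^ 3 * 2 \<le> s ^ 3 * (s / 4096)"
    using assms by (intro mult_left_mono) auto
  ultimately have "2 * s ^ 3 \<le> exp (s / 2)"
    by simp
  then have "1 / exp (s / 2) \<le> 1 / (2 * s ^ 3)"
    using assms by (intro divide_left_mono) auto
  then show ?thesis
    by (simp add: exp_minus inverse_eq_divide)
qed

text \<open>With s = 1 / (a z) and t = 1 / (a x), the right side is z - x: the map from x to g2 (1 /
  (a x)) has increments no larger than those of x where the SNR is at least a. For t at most 2 s
  this follows from the exponentially small Lipschitz constant; for larger t already g2 s is below
  the bound.\<close>

lemma g2_diff_le_inverse:
  assumes "a \<ge> 10000" "a \<le> s" "s \<le> t"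
  shows "g2 s - g2 t \<le> (1 / s - 1 / t) / a"
proof -
  have pos: "0 < a" "0 < s" "0 < t"
    using assms by auto
  have e: "exp (- s / 2) \<le> 1 / (2 * s ^ 3)"
    using assms by (intro exp_minus_half_le) auto
  have eq: "(1 / s - 1 / t) / a = (t - s) / (a * s * t)"
    using pos by (simp add: field_simps)
  show ?thesis
  proof (cases "t \<le> 2 * s")
    case True
    have "g2 s - g2 t \<le> exp (- s / 2) * (t - s)"
      using assms by (intro g2_diff_le) auto
    also have "\<dots> \<le> 1 / (2 * s ^ 3) * (t - s)"
      using assms e by (intro mult_right_mono) auto
    also have "\<dots> = (t - s) / (s * s * (2 * s))"
      by (simp add: power3_eq_cube)
    also have "\<dots> \<le> (t - s) / (a * s * t)"
      using assms pos True by (intro divide_left_mono mult_mono) auto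
    finally show ?thesis
      unfolding eq .
  next
    case False
    have "g2 s - g2 t \<le> 1 / (2 * s ^ 3)"
      using g2_le_exp[of s] g2_nonneg[of t] e pos by linarith
    also have "\<dots> \<le> 1 / (2 * (s * a))"
    proof (intro divide_left_mono mult_left_mono)
      have "s * a \<le> s * s * 1"
        using assms pos by simp
      also have "\<dots> \<le> s * s * s"
        using assms pos by (intro mult_left_mono) auto
      finally show "s * a \<le> s ^ 3"
        by (simp add: power3_eq_cube)
    qed (use pos in auto)
    also have "\<dots> = (1 / s - 1 / (2 * s)) / a"
      using pos by (simp add: field_simps)
    also have "\<dots> \<le> (1 / s - 1 / t) / a"
      using pos False by (intro divide_right_mono diff_left_mono divide_left_mono) auto
    finally show ?thesis .
  qed
qed

text \<open>Starting from the solution \<open>x1\<close>, the nonexpansive map cannot overtake the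
  identity as long as the SNR stays at least a, so the derivative of the landscape remains
  nonnegative.\<close>

lemma landscape_x1_le_large_snr:
  assumes "a \<ge> 10000" "v > 0" "x1 a v \<le> y" "a \<le> 1 / (a * y)"
  shows "landscape a v (x1 a v) \<le> landscape a v y"
proof (rule DERIV_nonneg_imp_nondecreasing[OF assms(3)])
  fix z assume z: "x1 a v \<le> z" "z \<le> y"
  have pos: "0 < a" "0 < x1 a v" "0 < z"
    using assms z x1_bounds(3)[of a v] by auto
  have "1 / (a * y) \<le> 1 / (a * z)"
    using pos z by (intro divide_left_mono mult_left_mono) auto
  then have "g2 (1 / (a * z)) - g2 (1 / (a * x1 a v)) \<le> (1 / (1 / (a * z)) - 1 / (1 / (a * x1 a v))) / a"
    using pos z assms by (intro g2_diff_le_inverse) (auto intro!: divide_left_mono)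
  also have "\<dots> = z - x1 a v"
    using pos by (simp add: field_simps)
  finally have "0 \<le> z - v - g2 (1 / (a * z))"
    using x1_bounds(4)[of a v] pos assms by linarith
  then show "\<exists>d. DERIV (landscape a v) z :> d \<and> 0 \<le> d"
    using has_real_derivative_landscape[of a z v] pos by (auto intro!: exI)
qed

subsection \<open>Load and rate at small noise\<close>

definition rate_x1 :: "real \<Rightarrow> real \<Rightarrow> real" where
  "rate_x1 a v = a * g2_primitive (1 / (a * x1 a v)) / (2 * ln 2)"

lemma ln2_bounds: "1 / 2 \<le> ln (2::real)" "ln (2::real) \<le> 1" "0 < ln (2::real)"
  using ln2_ge_two_thirds ln2_le_25_over_36 by linarith+

lemma coupled_rate_eq:
  assumes "a > 0" "v > 0"
  shows "coupled_rate a v = (if a \<le> limiting_load v then rate_x1 a v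
      else a * g2_primitive (1 / (a * x3 a v)) / (2 * ln 2))"
proof -
  have "0 < x1 a v" "0 < x3 a v"
    using char_solution_x1[OF assms] char_solution_x3[OF assms] by (auto simp: char_solution_def)
  with assms show ?thesis
    by (simp add: coupled_rate_def rate_x1_def biawgn_capacity_eq)
qed

lemma rate_le_load: "a > 0 \<Longrightarrow> 0 \<le> s \<Longrightarrow> a * g2_primitive s / (2 * ln 2) \<le> a"
  using g2_primitive_le_2ln2[of s] ln2_bounds by (simp add: divide_le_eq mult_left_mono)

lemma rate_x1_le_load: "a > 0 \<Longrightarrow> v > 0 \<Longrightarrow> rate_x1 a v \<le> a"
  unfolding rate_x1_def using x1_bounds(3)[of a v] by (intro rate_le_load) auto

text \<open>For a > 32 the SNR at x = 1/2 is below 1/16, where \<open>g2\<close> is still at least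
  1/2. Hence some solution, and so \<open>x3\<close>, is at least 1/2, and G s at most s bounds a G
  by 2. For smaller a the load itself bounds the rate.\<close>

lemma rate_x3_le:
  assumes "a > 0" "v > 0"
  shows "a * g2_primitive (1 / (a * x3 a v)) / (2 * ln 2) \<le> 32"
proof (cases "a \<le> 32")
  case True
  have "0 < x3 a v"
    using char_solution_x3[OF assms] by (auto simp: char_solution_def)
  with assms True rate_le_load[of a "1 / (a * x3 a v)"] show ?thesis
    by simp
next
  case False
  have "1 / 2 \<le> g2 (1 / 16)"
    using g2_ge_cubic[of "1 / 16"] by (simp add: power2_eq_square power3_eq_cube)
  also have "\<dots> \<le> g2 (1 / (a * (1 / 2)))"
    using False by (intro g2_antimono) (auto simp: field_simps)
  finally obtain x where "1 / 2 \<le> x" "char_solution a v x"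
    using char_solution_between[of a "1 / 2" "1 + v" v] assms g2_le_1[of "1 / (a * (1 + v))"] by auto
  then have x3: "1 / 2 \<le> x3 a v"
    using le_x3[OF assms] by force
  have "a * g2_primitive (1 / (a * x3 a v)) \<le> a * (1 / (a * x3 a v))"
    using assms x3 by (intro mult_left_mono g2_primitive_le) auto
  also have "\<dots> = 1 / x3 a v"
    using assms by simp
  also have "\<dots> \<le> 2"
    using x3 by (simp add: divide_le_eq)
  finally have "a * g2_primitive (1 / (a * x3 a v)) / (2 * ln 2) \<le> 2 / (2 * ln 2)"
    using ln2_bounds by (intro divide_right_mono) auto
  also have "\<dots> \<le> 32"
    using ln2_bounds by (simp add: divide_le_eq)
  finally show ?thesis .
qed

text \<open>Explicit thresholds replace the limit. The bound on the capacity puts the loads that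
  matter above the 10000 required by the landscape estimates; the second condition makes even C^2 v
  at most 1 / C^3, so noise terms disappear in the error.\<close>

locale small_noise =
  fixes v :: real
  assumes v_pos: "0 < v"
    and capacity_ge: "20000 \<le> awgn_capacity v"
    and v_small: "awgn_capacity v ^ 5 * v \<le> 1"
begin

abbreviation C :: real where "C \<equiv> awgn_capacity v"

definition c :: real where "c = 1 / C"

definition approx_load :: real where
  "approx_load = C - (c / (4 * ln 2) + c\<^sup>2 / (12 * ln 2))"

definition stable_loads :: "real set" where
  "stable_loads = {a \<in> {0<..C}. \<forall>x\<in>{0..1 + v}. potential v x a \<ge> 0}"

lemma c_bounds: "0 < c" "c \<le> 1 / 20000" "C * c = 1"
  using capacity_ge by (auto simp: c_def field_simps)

lemma square_capacity_noise_le: "C\<^sup>2 * v \<le> c ^ 3"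
proof -
  have "C\<^sup>2 * v = (C ^ 5 * v) * c ^ 3"
    using capacity_ge by (simp add: c_def field_simps eval_nat_numeral)
  also have "\<dots> \<le> 1 * c ^ 3"
    using v_small c_bounds by (intro mult_right_mono) auto
  finally show ?thesis
    by simp
qed

lemma v_le: "v \<le> c ^ 3"
proof -
  have "1 * v \<le> C\<^sup>2 * v"
    using v_pos capacity_ge by (intro mult_right_mono one_le_power) auto
  then show ?thesis
    using square_capacity_noise_le by simp
qed

lemma c_powers: "0 < c ^ 3" "c ^ 3 \<le> c\<^sup>2 / 20000" "c\<^sup>2 \<le> c / 20000" "0 < c\<^sup>2"
  using c_bounds mult_left_mono[of c "1 / 20000" "c\<^sup>2"] mult_left_mono[of c "1 / 20000" c]
  by (auto simp: power2_eq_square power3_eq_cube)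

lemma ln_v: "ln v = ln (1 + v) - 2 * ln 2 * C"
proof -
  have "1 + 1 / v = (1 + v) / v"
    using v_pos by (simp add: field_simps)
  then have "2 * ln 2 * C = ln ((1 + v) / v)"
    by (simp add: awgn_capacity_def log_def)
  then show ?thesis
    using v_pos by (simp add: ln_div)
qed

lemma ln_v_bounds: "- 2 * ln 2 * C \<le> ln v" "ln v \<le> v - 2 * ln 2 * C"
  using v_pos ln_add_one_self_le_self[of v] ln_ge_zero[of "1 + v"] by (auto simp: ln_v)

text \<open>1 / (4 C v) is half the SNR at load C and x = 2 v. The two bounds come from exp t being
  at least t and at least t^2 / 2.\<close>

lemma exp_tail_le: "exp (- (1 / (4 * C * v))) \<le> 4 * C * v" "exp (- (1 / (4 * C * v))) \<le> v"
proof -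
  have p: "0 < 4 * C * v"
    using v_pos capacity_ge by simp
  define t where "t = 1 / (4 * C * v)"
  have t: "0 < t"
    using p by (simp add: t_def)
  have "t \<le> exp t"
    using exp_ge_add_one_self[of t] by linarith
  then have "exp (- t) \<le> 1 / t"
    using t by (simp add: exp_minus inverse_eq_divide frac_le)
  then show "exp (- (1 / (4 * C * v))) \<le> 4 * C * v"
    by (simp add: t_def)
  have "t\<^sup>2 / 2 \<le> exp t"
    using exp_lower_Taylor_quadratic[of t] t by linarith
  then have "1 / exp t \<le> 1 / (t\<^sup>2 / 2)"
    using t by (intro divide_left_mono) auto
  also have "\<dots> = 32 * (C\<^sup>2 * v) * v"
    by (simp add: t_def power2_eq_square)
  also have "\<dots> \<le> 1 * v"
    using square_capacity_noise_le c_powers c_bounds v_pos by (intro mult_right_mono) auto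
  finally have "exp (- t) \<le> v"
    by (simp add: exp_minus inverse_eq_divide)
  then show "exp (- (1 / (4 * C * v))) \<le> v"
    by (simp add: t_def)
qed

text \<open>At x = 2 v the error \<open>g2\<close> is at most v, so the right side of the
  characteristic equation has dropped to at most 2 v and a solution lies in [v, 2 v].\<close>

lemma x1_le_2v:
  assumes "0 < a" "a \<le> C"
  shows "x1 a v \<le> 2 * v"
proof -
  have "a * (2 * v) * 2 \<le> 4 * C * v"
    using assms v_pos by simp
  then have "1 / (4 * C * v) \<le> 1 / (a * (2 * v) * 2)"
    using assms v_pos by (intro divide_left_mono mult_pos_pos) auto
  then have "exp (- (1 / (a * (2 * v))) / 2) \<le> exp (- (1 / (4 * C * v)))"
    by simp
  moreover have "g2 (1 / (a * (2 * v))) \<le> exp (- (1 / (a * (2 * v))) / 2)"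
    using assms v_pos by (intro g2_le_exp) simp
  ultimately have "g2 (1 / (a * (2 * v))) \<le> v"
    using exp_tail_le(2) by linarith
  moreover have "0 \<le> g2 (1 / (a * v))"
    using assms v_pos by (intro g2_nonneg) simp
  ultimately obtain x where "x \<le> 2 * v" "char_solution a v x"
    using char_solution_between[of a v "2 * v" v] assms v_pos by auto
  then show ?thesis
    using x1_le[OF assms(1) v_pos] by force
qed

text \<open>Since \<open>x1\<close> is at most 2 v, the SNR is so high that each unit of load
  carries almost a full bit; the total loss is at most 8 C^2 v.\<close>

lemma load_le_rate_x1:
  assumes "0 < a" "a \<le> C"
  shows "a \<le> rate_x1 a v + 8 * c ^ 3"
proof -
  define s where "s = 1 / (a * x1 a v)"
  have x: "0 < x1 a v"
    using x1_bounds(3)[OF assms(1) v_pos] .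
  have "2 * (a * x1 a v) \<le> 2 * (C * (2 * v))"
    using assms x x1_le_2v[OF assms] capacity_ge by (intro mult_left_mono mult_mono) auto
  then have "1 / (4 * C * v) \<le> 1 / (2 * (a * x1 a v))"
    using assms x by (intro divide_left_mono mult_pos_pos) (auto simp: v_pos mult_ac intro: less_le_trans)
  then have "exp (- s / 2) \<le> exp (- (1 / (4 * C * v)))"
    by (simp add: s_def)
  then have e: "exp (- s / 2) \<le> 4 * C * v"
    using exp_tail_le(1) by linarith
  have "2 * ln 2 * a - 2 * a * exp (- s / 2) = a * (2 * ln 2 - 2 * exp (- s / 2))"
    by (simp add: algebra_simps)
  also have "\<dots> \<le> a * g2_primitive s"
    using assms x by (intro mult_left_mono g2_primitive_ge_2ln2) (auto simp: s_def)
  also have "\<dots> = 2 * ln 2 * rate_x1 a v"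
    using ln2_bounds by (simp add: rate_x1_def s_def)
  finally have 1: "2 * ln 2 * (a - rate_x1 a v) \<le> 2 * a * exp (- s / 2)"
    by (simp add: algebra_simps)
  have "1 * (a - rate_x1 a v) \<le> 2 * ln 2 * (a - rate_x1 a v)"
    using ln2_bounds rate_x1_le_load[OF assms(1) v_pos] by (intro mult_right_mono) auto
  also note 1
  also have "2 * a * exp (- s / 2) \<le> 2 * C * (4 * C * v)"
    using assms e v_pos by (intro mult_mono) auto
  also have "\<dots> = 8 * (C\<^sup>2 * v)"
    by (simp add: power2_eq_square)
  finally show ?thesis
    using square_capacity_noise_le by simp
qed

lemma approx_load_bounds:
  shows approx_load_ge: "C - c \<le> approx_load - 600 * c ^ 3"
    and approx_load_le: "approx_load \<le> C"
proof -
  have "c / (4 * ln 2) \<le> c / 2"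
    using ln2_bounds c_bounds by (intro divide_left_mono) auto
  moreover have "c\<^sup>2 / (12 * ln 2) \<le> c\<^sup>2 / 6"
    using ln2_bounds by (intro divide_left_mono) auto
  moreover have "0 \<le> c / (4 * ln 2)" "0 \<le> c\<^sup>2 / (12 * ln 2)"
    using ln2_bounds c_bounds by auto
  ultimately show "C - c \<le> approx_load - 600 * c ^ 3" "approx_load \<le> C"
    unfolding approx_load_def using c_powers c_bounds by linarith+
qed

section \<open>Locating the limiting load\<close>

lemma potential_nonneg_iff:
  assumes "a > 0" "x \<ge> 0"
  shows "0 \<le> potential v x a \<longleftrightarrow> landscape a v (x1 a v) \<le> landscape a v (x + x1 a v)"
  using potential_eq[OF assms(1) v_pos assms(2)] by simp

lemma rate_x1_stable_le:
  assumes "a \<in> stable_loads" "C / 2 \<le> a"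
  shows "rate_x1 a v \<le> approx_load + 18 * c ^ 3"
proof -
  have a: "0 < a" "a \<le> C" "4 \<le> a"
    using assms capacity_ge by (auto simp: stable_loads_def)
  define y where "y = a / (a + 1)"
  have y: "1 / 2 \<le> y" "y \<le> 1"
    using a by (auto simp: y_def field_simps)
  have x: "x1 a v \<le> 1 / 2" "0 < x1 a v"
    using x1_le_2v[OF a(1,2)] v_le c_powers c_bounds x1_bounds(3)[OF a(1) v_pos] by linarith+
  then have "y - x1 a v \<in> {0..1 + v}"
    using y v_pos by auto
  then have "0 \<le> potential v (y - x1 a v) a"
    using assms by (simp add: stable_loads_def)
  then have "landscape a v (x1 a v) \<le> landscape a v y"
    using potential_nonneg_iff[of a "y - x1 a v"] a x y by simp
  also have "\<dots> \<le> 1 - 1 / (2 * a) - 1 / (6 * a\<^sup>2) + 2 / a ^ 3 + 2 * v"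
    unfolding y_def using a v_pos by (intro landscape_near_minimum_le) auto
  finally have 1: "a * g2_primitive (1 / (a * x1 a v)) \<le>
      1 - 1 / (2 * a) - 1 / (6 * a\<^sup>2) + 2 / a ^ 3 + 2 * v - ln v - 1"
    by (intro rate_x1_le a v_pos)
  define u where "u = 1 / a"
  have u: "c \<le> u" "u \<le> 2 * c"
    using a assms(2) capacity_ge by (auto simp: u_def c_def field_simps)
  have "c\<^sup>2 \<le> u\<^sup>2" "u ^ 3 \<le> 8 * c ^ 3"
    using u c_bounds power_mono[of c u 2] power_mono[of u "2 * c" 3] by (auto simp: power_mult_distrib)
  moreover have "2 * ln 2 * rate_x1 a v = a * g2_primitive (1 / (a * x1 a v))"
    using ln2_bounds by (simp add: rate_x1_def)
  moreover have "1 / (2 * a) = u / 2" "1 / (6 * a\<^sup>2) = u\<^sup>2 / 6" "2 / a ^ 3 = 2 * u ^ 3"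
    by (auto simp: u_def power_divide)
  \<comment> \<open>The 18 collects 2 / a^3, at most 16 c^3 because 1 / a is at most 2 c, and 2 v,
    at most 2 c^3.\<close>
  ultimately have "2 * ln 2 * rate_x1 a v \<le> 2 * ln 2 * C - c / 2 - c\<^sup>2 / 6 + 18 * c ^ 3"
    using 1 u v_le ln_v_bounds by linarith
  then have "rate_x1 a v \<le> (2 * ln 2 * C - c / 2 - c\<^sup>2 / 6 + 18 * c ^ 3) / (2 * ln 2)"
    using ln2_bounds by (simp add: pos_le_divide_eq mult.commute)
  also have "\<dots> = approx_load + 18 * c ^ 3 / (2 * ln 2)"
    unfolding approx_load_def using ln2_bounds by (simp add: field_simps)
  also have "18 * c ^ 3 / (2 * ln 2) \<le> 18 * c ^ 3 / 1"
    using ln2_bounds c_bounds by (intro divide_left_mono) auto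
  finally show ?thesis
    by simp
qed

lemma stable_load_le:
  assumes "a \<in> stable_loads"
  shows "a \<le> approx_load + 26 * c ^ 3"
proof (cases "C / 2 \<le> a")
  case True
  then show ?thesis
    using rate_x1_stable_le[OF assms] load_le_rate_x1[of a] assms by (simp add: stable_loads_def)
next
  case False
  then show ?thesis
    using approx_load_ge c_bounds c_powers capacity_ge by linarith
qed

text \<open>The margin 600 lowers \<open>landscape\<close> at \<open>x1\<close> by 2 ln 2 * 600 c^3,
  at least 600 c^3. This outweighs the error 66 / a^3, at most 528 c^3, of the lower bound near y =
  1 together with the cost of replacing 1 / a by c.\<close>

definition low_load :: real where
  "low_load = approx_load - 600 * c ^ 3"

lemma low_load_bounds: "C - c \<le> low_load" "low_load \<le> C" "10000 \<le> low_load"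
  using approx_load_ge approx_load_le c_powers c_bounds capacity_ge unfolding low_load_def by linarith+

lemma landscape_x1_low_load:
  "landscape low_load v (x1 low_load v) \<le> 1 - c / 2 - c\<^sup>2 / 6 - 599 * c ^ 3"
proof -
  have "landscape low_load v (x1 low_load v) \<le> ln v + 1 + 2 * ln 2 * low_load"
    using low_load_bounds v_pos by (intro landscape_x1_le) auto
  also have "2 * ln 2 * low_load = 2 * ln 2 * C - c / 2 - c\<^sup>2 / 6 - ln 2 * (1200 * c ^ 3)"
    unfolding low_load_def approx_load_def using ln2_bounds by (simp add: field_simps)
  also have "ln v + 1 + (2 * ln 2 * C - c / 2 - c\<^sup>2 / 6 - ln 2 * (1200 * c ^ 3)) \<le>
      1 - c / 2 - c\<^sup>2 / 6 - 599 * c ^ 3"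
    using ln_v_bounds v_le mult_right_mono[of "1 / 2" "ln 2" "1200 * c ^ 3"] ln2_bounds c_powers by linarith
  finally show ?thesis .
qed

lemma low_load_stable: "low_load \<in> stable_loads"
proof -
  define a where "a = low_load"
  have a: "10000 \<le> a" "a \<le> C" "C - c \<le> a" "0 < a"
    using low_load_bounds by (auto simp: a_def)
  have m: "landscape a v (x1 a v) \<le> 1 - c / 2 - c\<^sup>2 / 6 - 599 * c ^ 3"
    unfolding a_def by (rule landscape_x1_low_load)
  then have m1: "landscape a v (x1 a v) \<le> 1"
    using c_powers c_bounds by linarith
  have x: "0 < x1 a v" "x1 a v \<le> 2 * v"
    using x1_bounds(3)[OF a(4) v_pos] x1_le_2v[OF a(4,2)] by auto
  have "landscape a v (x1 a v) \<le> landscape a v y" if y: "x1 a v \<le> y" "y \<le> 2" for y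
  proof -
    \<comment> \<open>The SNR decides which landscape estimate applies: monotonicity from
      \<open>x1\<close> at very high SNR, the crude bound 1 in the two middle ranges, and the sharp
      expansion for y at least 1/2.\<close>
    consider "a \<le> 1 / (a * y)" | "1 / 16 \<le> 1 / (a * y)" "1 / (a * y) \<le> a"
      | "1 / (a * y) \<le> 1 / 16" "y \<le> 1 / 2" | "1 / 2 \<le> y"
      by linarith
    then show ?thesis
    proof cases
      case 1
      then show ?thesis
        using a v_pos y by (intro landscape_x1_le_large_snr) auto
    next
      case 2
      then show ?thesis
        using a v_pos x y m1 landscape_ge_1_medium_snr[of a v y] by auto
    next
      case 3
      then show ?thesis
        using a v_pos x y m1 landscape_ge_1_small_snr[of a v y] by auto
    next
      case 4
      define u where "u = 1 / a"
      have u: "c \<le> u" "u \<le> 2 * c" "0 < u"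
      proof -
        have "C \<le> 2 * a"
          using a c_bounds capacity_ge by linarith
        then show "c \<le> u" "u \<le> 2 * c" "0 < u"
          using a(2,4) capacity_ge by (auto simp: u_def c_def field_simps)
      qed
      \<comment> \<open>The load lies within c of the capacity, so exchanging 1 / a for 1 / C costs
        only a third-order term.\<close>
      have "u - c = (C - a) * (u * c)"
        using a capacity_ge by (simp add: u_def c_def field_simps)
      also have "\<dots> \<le> c * (2 * c * c)"
        using a u c_bounds by (intro mult_mono) auto
      finally have 1: "u - c \<le> 2 * c ^ 3"
        by (simp add: power3_eq_cube)
      have "u\<^sup>2 - c\<^sup>2 = (u - c) * (u + c)"
        by (simp add: power2_eq_square algebra_simps)
      also have "\<dots> \<le> 2 * c ^ 3 * 1"
        using 1 u c_bounds by (intro mult_mono) auto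
      finally have 2: "u\<^sup>2 - c\<^sup>2 \<le> 2 * c ^ 3"
        by simp
      have 3: "u ^ 3 \<le> 8 * c ^ 3"
        using u power_mono[of u "2 * c" 3] by (auto simp: power_mult_distrib)
      have "1 / (2 * a) = u / 2" "1 / (6 * a\<^sup>2) = u\<^sup>2 / 6" "66 / a ^ 3 = 66 * u ^ 3"
        by (auto simp: u_def power_divide)
      then have "1 - u / 2 - u\<^sup>2 / 6 - 66 * u ^ 3 \<le> landscape a v y"
        using landscape_ge_near_1[of a v y] a v_pos y 4 by simp
      then show ?thesis
        using 1 2 3 m c_powers by linarith
    qed
  qed
  moreover have "x + x1 a v \<le> 2" if "x \<le> 1 + v" for x
    using that x v_le c_powers c_bounds by linarith
  ultimately have "\<forall>x\<in>{0..1 + v}. 0 \<le> potential v x a"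
    using a by (auto simp: potential_nonneg_iff)
  with a show ?thesis
    by (simp add: stable_loads_def a_def)
qed

lemma limiting_load_bounds:
  "low_load \<le> limiting_load v" "limiting_load v \<le> approx_load + 26 * c ^ 3" "limiting_load v \<le> C"
proof -
  have eq: "limiting_load v = Sup stable_loads"
    by (simp add: limiting_load_def stable_loads_def)
  have C: "a \<le> C" if "a \<in> stable_loads" for a
    using that by (simp add: stable_loads_def)
  then have "bdd_above stable_loads"
    by (rule bdd_aboveI)
  then show "low_load \<le> limiting_load v"
    unfolding eq using low_load_stable by (rule cSup_upper[rotated])
  show "limiting_load v \<le> approx_load + 26 * c ^ 3" "limiting_load v \<le> C"
    unfolding eq using low_load_stable stable_load_le C by (auto intro!: cSup_least)
qed

lemma rate_low_load: "approx_load - 608 * c ^ 3 \<le> rate_x1 low_load v"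
  using load_le_rate_x1[of low_load] low_load_bounds by (simp add: low_load_def)

lemma rate_low_load_ge_32: "32 \<le> rate_x1 low_load v"
  using rate_low_load low_load_bounds c_powers c_bounds unfolding low_load_def by linarith

lemma coupled_rate_low_load: "coupled_rate low_load v = rate_x1 low_load v"
  using coupled_rate_eq[of low_load v] limiting_load_bounds(1) low_load_bounds v_pos by simp

lemma coupled_rate_le:
  assumes "b > 0"
  shows "coupled_rate b v \<le> approx_load + 26 * c ^ 3"
proof (cases "b \<le> limiting_load v")
  case True
  then show ?thesis
    using coupled_rate_eq[OF assms v_pos] rate_x1_le_load[OF assms v_pos] limiting_load_bounds(2) by simp
next
  case False
  have "32 \<le> approx_load"
    using low_load_bounds c_powers unfolding low_load_def by linarith
  moreover have "coupled_rate b v \<le> 32"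
    using False coupled_rate_eq[OF assms v_pos] rate_x3_le[OF assms v_pos] by simp
  ultimately show ?thesis
    using c_powers by linarith
qed

section \<open>Attainment of the maximum and the capacity gap\<close>

lemma continuous_on_g2_primitive: "continuous_on {0..} g2_primitive"
  by (rule DERIV_continuous_on[OF has_real_derivative_g2_primitive_nonneg]) simp

text \<open>The smallest solution need not depend continuously on the load, so the rate is maximised
  over the compact set of pairs of a load and any of its solutions. A smaller solution gives a
  larger rate, so the maximum is reached with \<open>x1\<close>. Loads below 1 or beyond the
  limiting load give at most 32, which \<open>low_load\<close> already achieves.\<close>

lemma coupled_rate_attains_max: "\<exists>a>0. \<forall>b>0. coupled_rate b v \<le> coupled_rate a v"
proof -
  define K where "K = {p \<in> {1..limiting_load v} \<times> {v..1 + v}. snd p - g2 (1 / (fst p * snd p)) = v}"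
  define F where "F p = fst p * g2_primitive (1 / (fst p * snd p)) / (2 * ln 2)" for p
  have pos: "0 < fst p" "0 < snd p" if "p \<in> {1..limiting_load v} \<times> {v..1 + v}" for p
    using that v_pos by auto
  have snr: "continuous_on ({1..limiting_load v} \<times> {v..1 + v}) (\<lambda>p. 1 / (fst p * snd p))"
    by (intro continuous_intros) (use pos in force)
  have nonneg: "(\<lambda>p. 1 / (fst p * snd p)) ` ({1..limiting_load v} \<times> {v..1 + v}) \<subseteq> {0..}"
  proof (rule image_subsetI)
    fix p assume "p \<in> {1..limiting_load v} \<times> {v..1 + v}"
    then have "0 < fst p * snd p"
      using pos by (intro mult_pos_pos)
    then show "1 / (fst p * snd p) \<in> {0..}"
      by simp
  qed
  have "compact K"
  proof -
    have "closed K"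
      unfolding K_def
      by (intro continuous_closed_preimage_constant continuous_intros
          continuous_on_compose2[OF continuous_on_g2 snr nonneg] closed_Times)
    moreover have "bounded K"
      by (rule bounded_subset[OF bounded_Times[OF bounded_closed_interval bounded_closed_interval,
              of 1 "limiting_load v" v "1 + v"]]) (unfold K_def, rule Collect_restrict)
    ultimately show ?thesis
      by (simp add: compact_eq_bounded_closed)
  qed
  have K_x1: "(a, x1 a v) \<in> K" if "1 \<le> a" "a \<le> limiting_load v" for a
    using that x1_bounds[of a v] v_pos by (auto simp: K_def)
  have F_x1: "F (a, x1 a v) = rate_x1 a v" for a
    by (simp add: F_def rate_x1_def)
  have low: "(low_load, x1 low_load v) \<in> K"
    using low_load_bounds limiting_load_bounds by (intro K_x1) auto
  have "continuous_on K F"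
  proof -
    have "continuous_on ({1..limiting_load v} \<times> {v..1 + v}) F"
      unfolding F_def [abs_def] using ln2_bounds
      by (intro continuous_intros continuous_on_compose2[OF continuous_on_g2_primitive snr nonneg]) auto
    then show ?thesis
      by (rule continuous_on_subset) (auto simp: K_def)
  qed
  with \<open>compact K\<close> low obtain p where p: "p \<in> K" "\<And>q. q \<in> K \<Longrightarrow> F q \<le> F p"
    using continuous_attains_sup[of K F] by blast
  obtain a x where ax: "p = (a, x)"
    by (cases p)
  have a: "1 \<le> a" "a \<le> limiting_load v" "0 < a" and x: "char_solution a v x" "0 < x"
    using p(1) v_pos by (auto simp: K_def ax char_solution_def)
  have "F p \<le> rate_x1 a v"
  proof -
    have "0 < x1 a v" "x1 a v \<le> x"
      using x1_bounds(3)[OF a(3) v_pos] x1_le[OF a(3) v_pos x(1)] by auto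
    then have "g2_primitive (1 / (a * x)) \<le> g2_primitive (1 / (a * x1 a v))"
      using a x by (intro g2_primitive_mono divide_left_mono mult_left_mono) auto
    then show ?thesis
      unfolding F_def rate_x1_def ax using a ln2_bounds
      by (auto intro!: divide_right_mono mult_left_mono)
  qed
  then have max: "rate_x1 b v \<le> coupled_rate a v" if "1 \<le> b" "b \<le> limiting_load v" for b
    using p(2)[OF K_x1[OF that]] a v_pos by (simp add: F_x1 coupled_rate_eq)
  have a32: "32 \<le> coupled_rate a v"
    using max[of low_load] rate_low_load_ge_32 low_load_bounds limiting_load_bounds by linarith
  have "coupled_rate b v \<le> coupled_rate a v" if b: "0 < b" for b
  proof -
    consider "b \<le> limiting_load v" "1 \<le> b" | "b \<le> limiting_load v" "b \<le> 1" | "limiting_load v < b"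
      by linarith
    then show ?thesis
    proof cases
      case 1
      then show ?thesis
        using max[of b] b v_pos coupled_rate_eq[of b v] by simp
    next
      case 2
      then show ?thesis
        using rate_x1_le_load[OF b v_pos] b v_pos a32 coupled_rate_eq[of b v] by simp
    next
      case 3
      then show ?thesis
        using rate_x3_le[OF b v_pos] b v_pos a32 coupled_rate_eq[of b v] by simp
    qed
  qed
  with a show ?thesis
    by blast
qed

text \<open>The upper bound 26 = 18 + 8 adds the stable-rate error and the gap between load and
  rate; the lower bound 608 = 600 + 8 adds the margin of \<open>low_load\<close> and the same
  gap.\<close>

lemma capacity_gap:
  "\<bar>C - (SUP a\<in>{0<..}. coupled_rate a v) - (1 / (4 * ln 2 * C) + 1 / (12 * ln 2 * C\<^sup>2))\<bar> \<le> 608 / C ^ 3"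
proof -
  let ?M = "SUP a\<in>{0<..}. coupled_rate a v"
  have "?M \<le> approx_load + 26 * c ^ 3"
    using coupled_rate_le by (intro cSUP_least) auto
  moreover have "approx_load - 608 * c ^ 3 \<le> ?M"
    using coupled_rate_le rate_low_load low_load_bounds
    by (intro cSUP_upper2[where x = low_load]) (auto intro!: bdd_aboveI2 simp: coupled_rate_low_load)
  moreover have "approx_load = C - (1 / (4 * ln 2 * C) + 1 / (12 * ln 2 * C\<^sup>2))"
    by (simp add: approx_load_def c_def power_divide mult_ac)
  moreover have "608 / C ^ 3 = 608 * c ^ 3"
    by (simp add: c_def power_divide)
  ultimately show ?thesis
    using c_powers by linarith
qed

end

lemma eventually_small_noise: "\<forall>\<^sub>F v in at_right 0. small_noise v"
proof -
  have "\<forall>\<^sub>F v::real in at_right 0. 0 < v"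
    by (rule eventually_at_right_less)
  moreover have "\<forall>\<^sub>F v in at_right 0. 20000 \<le> awgn_capacity v"
    unfolding awgn_capacity_def by real_asymp
  moreover have "\<forall>\<^sub>F v in at_right 0. awgn_capacity v ^ 5 * v \<le> 1"
    unfolding awgn_capacity_def by real_asymp
  ultimately show ?thesis
    by eventually_elim (rule small_noise.intro)
qed

text \<open>The first conjunct certifies that for small noise the supremum in the second is a
  maximum over positive loads, as the claim demands.\<close>

theorem theorem2:
  shows "(\<forall>\<^sub>F v in at_right 0. \<exists>a>0. \<forall>b>0. coupled_rate b v \<le> coupled_rate a v) \<and>
    (\<lambda>v. awgn_capacity v - (SUP a\<in>{0<..}. coupled_rate a v)
          - (1 / (4 * ln 2 * awgn_capacity v) + 1 / (12 * ln 2 * (awgn_capacity v)^2)))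
      \<in> O[at_right 0](\<lambda>v. 1 / (awgn_capacity v)^3)"
proof
  show "\<forall>\<^sub>F v in at_right 0. \<exists>a>0. \<forall>b>0. coupled_rate b v \<le> coupled_rate a v"
    using eventually_small_noise by eventually_elim (rule small_noise.coupled_rate_attains_max)
  show "(\<lambda>v. awgn_capacity v - (SUP a\<in>{0<..}. coupled_rate a v)
          - (1 / (4 * ln 2 * awgn_capacity v) + 1 / (12 * ln 2 * (awgn_capacity v)^2)))
      \<in> O[at_right 0](\<lambda>v. 1 / (awgn_capacity v)^3)"
  proof (rule bigoI)
    show "\<forall>\<^sub>F v in at_right 0. norm (awgn_capacity v - (SUP a\<in>{0<..}. coupled_rate a v)
          - (1 / (4 * ln 2 * awgn_capacity v) + 1 / (12 * ln 2 * (awgn_capacity v)^2)))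
        \<le> 608 * norm (1 / (awgn_capacity v)^3)"
      using eventually_small_noise
    proof eventually_elim
      case (elim v)
      then interpret small_noise v .
      show ?case
        using capacity_gap capacity_ge by simp
    qed
  qed
qed

end
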